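(* Let $f:\mathbb{R}^d\to\mathbb{R}$ be twice differentiable and bounded from below ($\min_{\mathbf{x}} f(\mathbf{x})>-\infty$), with $L$-Lipschitz gradient and $\rho$-Lipschitz Hessian ($L,\rho>0$). Let $\epsilon>0$, $\eta=\frac{1}{4L}$, $B=\sqrt{\frac{\epsilon}{\rho}}$, $\theta=4(\epsilon\rho\eta^2)^{1/4}\in(0,1]$, and $K=\frac{1}{\theta}$. Let $\mathbf{x}_{int}\in\mathbb{R}^d$ and $\triangle_f=f(\mathbf{x}_{int})-\min_{\mathbf{x}}f(\mathbf{x})$. Then the restarted accelerated gradient descent algorithm RAGD-NC (described in the context), run from $\mathbf{x}_{int}$ with these parameters, terminates in at most $\frac{\triangle_f L^{1/2}\rho^{1/4}}{\epsilon^{7/4}}$ gradient computations, and its output $\hat{\mathbf{y}}$ satisfies $\|\nabla f(\hat{\mathbf{y}})\|\leq 82\epsilon$.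
   Context: $\|\cdot\|$ is the Euclidean norm on $\mathbb{R}^d$ and $\|\cdot\|_2$ the spectral norm. $L$-Lipschitz gradient: $\|\nabla f(\mathbf{x})-\nabla f(\mathbf{y})\|\le L\|\mathbf{x}-\mathbf{y}\|$ for all $\mathbf{x},\mathbf{y}$. $\rho$-Lipschitz Hessian: $\|\nabla^2 f(\mathbf{x})-\nabla^2 f(\mathbf{y})\|_2\le\rho\|\mathbf{x}-\mathbf{y}\|$ for all $\mathbf{x},\mathbf{y}$. Algorithm RAGD-NC (parameters $\eta,B,\theta,K$; starting point $\mathbf{x}_{int}$): 1. Initialize $\mathbf{x}^{-1}=\mathbf{x}^0=\mathbf{x}_{int}$, $k=0$. 2. While $k<K$ do: (i) $\mathbf{y}^k=\mathbf{x}^k+(1-\theta)(\mathbf{x}^k-\mathbf{x}^{k-1})$; (ii) $\mathbf{x}^{k+1}=\mathbf{y}^k-\eta\nabla f(\mathbf{y}^k)$; (iii) $k\leftarrow k+1$; (iv) if $k\sum_{t=0}^{k-1}\|\mathbf{x}^{t+1}-\mathbf{x}^t\|^2>B^2$, then restart: set $\mathbf{x}^{-1}=\mathbf{x}^0=\mathbf{x}^k$ and $k=0$ (the iterates are re-indexed from the new starting point). 3. After the loop, let $K_0=\operatorname{argmin}_{\lfloor K/2\rfloor\le k\le K-1}\|\mathbf{x}^{k+1}-\mathbf{x}^k\|$ and output $\hat{\mathbf{y}}=\frac{1}{K_0+1}\sum_{k=0}^{K_0}\mathbf{y}^k$ (iterates of the last round, i.e. since the last restart).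
   Formalization: The bound on gradient computations is proved as the maximum of the printed bound and K rounded up: every run makes at least that many, so the printed bound fails when smaller (for f = 0 it is 0). Otherwise it is as printed. *)

theory Defs
  imports "HOL-Analysis.Analysis"
begin

definition gradient :: "('a::real_inner \<Rightarrow> real) \<Rightarrow> 'a \<Rightarrow> 'a" where
  "gradient f x = (THE g. GDERIV f x :> g)"

definition hessian :: "(real^'d \<Rightarrow> real) \<Rightarrow> real^'d \<Rightarrow> real^'d^'d" where
  "hessian f x = matrix (frechet_derivative (gradient f) (at x))"

definition twice_differentiable :: "(real^'d \<Rightarrow> real) \<Rightarrow> bool" where
  "twice_differentiable f \<longleftrightarrow>
     (\<forall>x. f differentiable (at x)) \<and> (\<forall>x. gradient f differentiable (at x))"

text \<open>The norm on matrices provided by the type class is the Frobenius norm, so the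
  spectral norm is written as an operator norm.\<close>

definition spectral_norm :: "real^'n^'m \<Rightarrow> real" where
  "spectral_norm A = onorm ((*v) A)"

definition lipschitz_gradient :: "real \<Rightarrow> (real^'d \<Rightarrow> real) \<Rightarrow> bool" where
  "lipschitz_gradient L f \<longleftrightarrow>
     (\<forall>x y. norm (gradient f x - gradient f y) \<le> L * norm (x - y))"

definition lipschitz_hessian :: "real \<Rightarrow> (real^'d \<Rightarrow> real) \<Rightarrow> bool" where
  "lipschitz_hessian \<rho> f \<longleftrightarrow>
     (\<forall>x y. spectral_norm (hessian f x - hessian f y) \<le> \<rho> * norm (x - y))"

text \<open>\<open>agd f \<eta> \<theta> z k\<close> is the pair of iterates \<open>(x\<^sup>k\<^sup>-\<^sup>1, x\<^sup>k)\<close> of the round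
  started at \<open>z\<close>, that is, with \<open>x\<^sup>-\<^sup>1 = x\<^sup>0 = z\<close>; the restart test is not applied here.\<close>

primrec agd ::
  "(real^'d \<Rightarrow> real) \<Rightarrow> real \<Rightarrow> real \<Rightarrow> real^'d \<Rightarrow> nat \<Rightarrow> (real^'d) \<times> (real^'d)" where
  "agd f \<eta> \<theta> z 0 = (z, z)"
| "agd f \<eta> \<theta> z (Suc k) =
     (let (x', x) = agd f \<eta> \<theta> z k;
          y = x + (1 - \<theta>) *\<^sub>R (x - x')
      in (x, y - \<eta> *\<^sub>R gradient f y))"

definition agd_x ::
  "(real^'d \<Rightarrow> real) \<Rightarrow> real \<Rightarrow> real \<Rightarrow> real^'d \<Rightarrow> nat \<Rightarrow> real^'d" where
  "agd_x f \<eta> \<theta> z k = snd (agd f \<eta> \<theta> z k)"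

definition agd_y ::
  "(real^'d \<Rightarrow> real) \<Rightarrow> real \<Rightarrow> real \<Rightarrow> real^'d \<Rightarrow> nat \<Rightarrow> real^'d" where
  "agd_y f \<eta> \<theta> z k =
     (let (x', x) = agd f \<eta> \<theta> z k in x + (1 - \<theta>) *\<^sub>R (x - x'))"

text \<open>Since the iterates of a round are determined by its starting point, the state of the
  algorithm is a pair \<open>(z, k)\<close>: the starting point of the current round, and the counter.
  One pass through the loop body is the following function; it evaluates the gradient
  exactly once, at \<open>y\<^sup>k\<close>.\<close>

definition ragd_step ::
  "(real^'d \<Rightarrow> real) \<Rightarrow> real \<Rightarrow> real \<Rightarrow> real \<Rightarrow> (real^'d) \<times> nat \<Rightarrow> (real^'d) \<times> nat" where
  "ragd_step f \<eta> B \<theta> = (\<lambda>(z, k).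
     let x = agd_x f \<eta> \<theta> z in
     if real (k + 1) * (\<Sum>t<k + 1. (norm (x (t + 1) - x t))\<^sup>2) > B\<^sup>2
     then (x (k + 1), 0)
     else (z, k + 1))"

text \<open>\<open>ragd_loop f \<eta> B \<theta> K s n s'\<close>: the loop, entered in state \<open>s\<close>, exits in state \<open>s'\<close> after
  \<open>n\<close> passes through its body, hence after \<open>n\<close> gradient computations.\<close>

inductive ragd_loop ::
  "(real^'d \<Rightarrow> real) \<Rightarrow> real \<Rightarrow> real \<Rightarrow> real \<Rightarrow> real \<Rightarrow>
   (real^'d) \<times> nat \<Rightarrow> nat \<Rightarrow> (real^'d) \<times> nat \<Rightarrow> bool"
  for f \<eta> B \<theta> K where
  exit: "\<not> real (snd s) < K \<Longrightarrow> ragd_loop f \<eta> B \<theta> K s 0 s"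
| iterate: "real (snd s) < K \<Longrightarrow> ragd_loop f \<eta> B \<theta> K (ragd_step f \<eta> B \<theta> s) n s' \<Longrightarrow>
    ragd_loop f \<eta> B \<theta> K s (Suc n) s'"

text \<open>The parameter \<open>K\<close> is a real number. The minimizing index need not be unique; every
  minimizer is an admissible choice.\<close>

definition ragd_output ::
  "(real^'d \<Rightarrow> real) \<Rightarrow> real \<Rightarrow> real \<Rightarrow> real \<Rightarrow> real^'d \<Rightarrow> real^'d \<Rightarrow> bool" where
  "ragd_output f \<eta> \<theta> K z yhat \<longleftrightarrow>
     (\<exists>k0. is_arg_min (\<lambda>k. norm (agd_x f \<eta> \<theta> z (k + 1) - agd_x f \<eta> \<theta> z k))
             (\<lambda>k. \<lfloor>K / 2\<rfloor> \<le> int k \<and> real k \<le> K - 1) k0 \<and>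
           yhat = (1 / real (k0 + 1)) *\<^sub>R (\<Sum>k\<le>k0. agd_y f \<eta> \<theta> z k))"

text \<open>The algorithm started at \<open>x_int\<close> can terminate after exactly \<open>n\<close> gradient computations
  with output \<open>yhat\<close>.\<close>

definition ragd_nc ::
  "(real^'d \<Rightarrow> real) \<Rightarrow> real \<Rightarrow> real \<Rightarrow> real \<Rightarrow> real \<Rightarrow> real^'d \<Rightarrow> nat \<Rightarrow> real^'d \<Rightarrow> bool" where
  "ragd_nc f \<eta> B \<theta> K x_int n yhat \<longleftrightarrow>
     (\<exists>z k. ragd_loop f \<eta> B \<theta> K (x_int, 0) n (z, k) \<and> ragd_output f \<eta> \<theta> K z yhat)"

end

theory Submission
  imports Defs
begin

text \<open>The unit of progress is \<open>\<rho> * B^3\<close>, and the parameters enter through the relations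
  \<open>\<eta> = 1 / (4 * L)\<close>, \<open>\<theta>\<^sup>2 = 16 * \<eta> * \<rho> * B\<close> and \<open>K = 1 / \<theta>\<close>.

  Inside one round, every iterate before a restart stays within \<open>B\<close> of the starting point
  \<open>x 0\<close>, since the squared displacement after \<open>k\<close> steps is at most \<open>k\<close> times the sum of the
  squared steps, which is what the restart test monitors. On such a ball \<open>f\<close> differs from its
  quadratic Taylor model at \<open>x 0\<close> by \<open>O(\<rho> * B^3)\<close> and its gradient from that of the model by
  \<open>O(\<rho> * B\<^sup>2)\<close>. In an orthonormal eigenbasis of the Hessian at \<open>x 0\<close> the method therefore splits
  into one-dimensional accelerated gradient methods for quadratics with perturbed gradients. A
  coordinate with curvature above \<open>- \<theta> / \<eta>\<close> is dissipative for the usual energy, the value plus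
  a kinetic term; in a coordinate with curvature below that threshold the iterate runs away from
  the maximum and the negative curvature itself pays for each step. Both kinds lose at least
  \<open>3 * \<theta> / (8 * \<eta>)\<close> times the squared step length, up to the perturbation
  (\<open>coordinate_decrease\<close>, summed up in \<open>model_decrease\<close>).

  A restart happens precisely when the squared step lengths are large, so a restarted round
  decreases \<open>f\<close> substantially: by at least \<open>\<lceil>K\<rceil> / K\<close> units (\<open>restart_decrease\<close>). In the
  \<open>potential\<close>, which is \<open>2 * K\<close> times the suboptimality in these units, this is \<open>2 * \<lceil>K\<rceil>\<close>: each
  restarted round pays for its own at most \<open>\<lceil>K\<rceil>\<close> gradients and for as many more, and the
  surplus of a single restart covers the final round. This explains the maximum in the bound:
  without any restart the run consists of \<open>\<lceil>K\<rceil>\<close> gradients, and with one or more it is covered by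
  the initial potential (\<open>loop_length\<close>).

  In the round that is not restarted, the average of the gradients telescopes to the last step
  and \<open>\<theta>\<close> times the displacement, divided by \<open>\<eta>\<close> times the number of steps. The displacement is at most
  \<open>B\<close>, and choosing the shortest step in the second half of the round makes the last step of
  order \<open>\<theta> * B\<close>. As the model gradient is affine, averaging the gradients and taking the gradient
  at the average agree up to \<open>4 * \<rho> * B\<^sup>2\<close> (\<open>average_iterate\<close>, \<open>small_gradient_at_output\<close>).\<close>

section \<open>Orthonormal eigenbases of symmetric linear maps\<close>

lemma quadratic_nonpos_imp_linear_coeff_0:
  fixes a c :: real
  assumes "\<And>t. 2 * t * a + t\<^sup>2 * c \<le> 0"
  shows "a = 0"
proof (rule ccontr)
  assume "a \<noteq> 0"
  define q where "q = \<bar>c\<bar> + 1"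
  have q: "q > 0" "2 * q + c > 0" by (auto simp: q_def)
  have "2 * (a / q) * a + (a / q)\<^sup>2 * c = a\<^sup>2 * (2 * q + c) / q\<^sup>2"
    using q(1) by (simp add: field_simps power2_eq_square)
  also have "\<dots> > 0" using q \<open>a \<noteq> 0\<close> by simp
  finally show False using assms[of "a / q"] by linarith
qed

text \<open>A maximizer \<open>u\<close> of the quadratic form on the unit sphere of \<open>S\<close> is an eigenvector: moving
  from \<open>u\<close> in the direction of the residual \<open>T u - l *\<^sub>R u\<close>, which is orthogonal to \<open>u\<close>, has
  vanishing first-order effect, and this effect is the squared norm of the residual.\<close>
lemma symmetric_map_has_eigenvector:
  fixes T :: "'a::euclidean_space \<Rightarrow> 'a"
  assumes T: "linear T" "\<And>x y. x \<bullet> T y = T x \<bullet> y"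
    and S: "subspace S" "T ` S \<subseteq> S" "S \<noteq> {0}"
  obtains u l where "u \<in> S" "norm u = 1" "T u = l *\<^sub>R u"
proof -
  have lin: "T (x + y) = T x + T y" "T (c *\<^sub>R x) = c *\<^sub>R T x" for x y c
    using T(1) by (auto simp: linear_add linear_cmul)
  define C where "C = S \<inter> sphere 0 1"
  have "compact C"
    unfolding C_def by (intro closed_Int_compact closed_subspace S compact_sphere)
  obtain w where w: "w \<in> S" "w \<noteq> 0" using S subspace_0 by fastforce
  have "w /\<^sub>R norm w \<in> C" using w S(1) by (simp add: C_def subspace_scale)
  then have "C \<noteq> {}" by blast
  have "continuous_on C (\<lambda>x. x \<bullet> T x)"
    using T(1) by (intro continuous_intros linear_continuous_on linear_conv_bounded_linear[THEN iffD1])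
  then obtain u where u: "u \<in> C" "\<And>x. x \<in> C \<Longrightarrow> x \<bullet> T x \<le> u \<bullet> T u"
    using continuous_attains_sup[OF \<open>compact C\<close> \<open>C \<noteq> {}\<close>] by blast
  define l where "l = u \<bullet> T u"
  have uu: "u \<in> S" "norm u = 1" "u \<bullet> u = 1" using u(1) by (auto simp: C_def norm_eq_1)
  have max: "x \<bullet> T x \<le> l * (x \<bullet> x)" if "x \<in> S" for x
  proof (cases "x = 0")
    case False
    have "x /\<^sub>R norm x \<in> C" using that False S(1) by (simp add: C_def subspace_scale)
    from u(2)[OF this] show ?thesis using False
      by (simp add: lin l_def field_simps dot_square_norm power2_eq_square)
  qed simp
  define w where "w = T u - l *\<^sub>R u"
  have wS: "w \<in> S" using S uu by (auto simp: w_def intro!: subspace_diff subspace_scale)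
  have wu: "w \<bullet> u = 0" using uu by (simp add: w_def inner_diff l_def inner_commute)
  have "w \<bullet> T u = 0"
  proof (rule quadratic_nonpos_imp_linear_coeff_0)
    fix t :: real
    have "u + t *\<^sub>R w \<in> S" using S(1) uu wS by (intro subspace_add subspace_scale)
    from max[OF this] show "2 * t * (w \<bullet> T u) + t\<^sup>2 * (w \<bullet> T w - l * (w \<bullet> w)) \<le> 0"
      using wu uu(3) T(2)[of u w] unfolding l_def[symmetric]
      by (simp add: lin inner_add_left inner_add_right inner_commute algebra_simps power2_eq_square l_def)
  qed
  then have "w \<bullet> w = 0" using wu by (simp add: w_def inner_diff_right)
  then show ?thesis using that[OF uu(1,2), of l] by (simp add: w_def)
qed

text \<open>The orthogonal complement of an eigenvector inside an invariant subspace is again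
  invariant by symmetry, so the basis is built by induction on the dimension.\<close>
lemma symmetric_map_has_orthonormal_eigenbasis:
  fixes T :: "'a::euclidean_space \<Rightarrow> 'a"
  assumes T: "linear T" "\<And>x y. x \<bullet> T y = T x \<bullet> y"
    and "subspace S" "T ` S \<subseteq> S"
  shows "\<exists>B. finite B \<and> pairwise orthogonal B \<and> (\<forall>b\<in>B. norm b = 1 \<and> (\<exists>l. T b = l *\<^sub>R b)) \<and> span B = S"
  using assms(3,4)
proof (induction "dim S" arbitrary: S rule: less_induct)
  case less
  show ?case
  proof (cases "S = {0}")
    case True
    then show ?thesis by (intro exI[of _ "{}"]) auto
  next
    case False
    obtain u l where u: "u \<in> S" "norm u = 1" "T u = l *\<^sub>R u"
      using symmetric_map_has_eigenvector[OF T less.prems False] .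
    define W where "W = {y \<in> S. \<forall>x\<in>span {u}. orthogonal x y}"
    have W_eq: "W = {y \<in> S. u \<bullet> y = 0}"
      by (auto simp: W_def orthogonal_def span_singleton)
    have "subspace W" unfolding W_eq using less.prems(1)
      by (auto simp: subspace_def inner_add_right)
    moreover have "dim W + dim (span {u}) = dim S"
      unfolding W_def by (intro dim_subspace_orthogonal_to_vectors subspace_span less.prems(1) span_minimal)
        (use u in auto)
    moreover have "dim (span {u}) = 1" using u(2)
      by (auto simp: dim_span dim_singleton)
    moreover have "T ` W \<subseteq> W"
      using less.prems(2) T(2)[of u] u(3) by (auto simp: W_eq)
    ultimately obtain B where B: "finite B" "pairwise orthogonal B"
      "\<forall>b\<in>B. norm b = 1 \<and> (\<exists>l. T b = l *\<^sub>R b)" "span B = W"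
      using less.hyps[of W] by auto
    have uB: "orthogonal u b" "orthogonal b u" if "b \<in> B" for b
      using that B(4) span_base[of b B] by (auto simp: W_eq orthogonal_def inner_commute)
    have "span (insert u B) = S"
    proof
      show "span (insert u B) \<subseteq> S"
        using span_superset[of B] unfolding B(4) 
        by (intro span_minimal less.prems(1)) (auto simp: u W_eq)
      show "S \<subseteq> span (insert u B)"
      proof
        fix x assume "x \<in> S"
        then have "x - (u \<bullet> x) *\<^sub>R u \<in> W"
          using less.prems(1) u norm_eq_1[of u] by (auto simp: W_eq inner_diff_right intro!: subspace_diff subspace_scale)
        then show "x \<in> span (insert u B)" using B(4) by (auto simp: span_insert)
      qed
    qed
    then show ?thesis using B uB u
      by (intro exI[of _ "insert u B"]) (auto simp: pairwise_insert)
  qed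
qed

lemma orthonormal_inner_expansion:
  fixes x y :: "'a::euclidean_space"
  assumes "finite B" "pairwise orthogonal B" "\<And>b. b \<in> B \<Longrightarrow> norm b = 1" "span B = UNIV"
  shows "x \<bullet> y = (\<Sum>b\<in>B. (x \<bullet> b) * (y \<bullet> b))"
proof -
  obtain a where a: "x = (\<Sum>v\<in>B. a v *\<^sub>R v)"
    using assms(1,4) span_finite[of B] by auto
  have "x \<bullet> b = a b" if "b \<in> B" for b
  proof -
    have "x \<bullet> b = (\<Sum>v\<in>B. a v * (v \<bullet> b))" by (simp add: a inner_sum_left)
    also have "\<dots> = (\<Sum>v\<in>B. if v = b then a v else 0)"
      using assms(2,3) that by (intro sum.cong) (auto simp: pairwise_def orthogonal_def norm_eq_1)
    finally show ?thesis using that assms(1) by simp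
  qed
  moreover have "x \<bullet> y = (\<Sum>b\<in>B. a b * (y \<bullet> b))"
    by (simp add: a inner_sum_left inner_commute[of y])
  ultimately show ?thesis by simp
qed

section \<open>Taylor estimates from Lipschitz derivatives\<close>

text \<open>The mean value inequality in the form in which all Taylor remainders are derived
  here: differentiating the remainder along a segment leaves a bound that is a power of the
  parameter, and this power is integrated by exhibiting its antiderivative \<open>p\<close>.\<close>
lemma increment_bound_on_unit_interval:
  fixes g :: "real \<Rightarrow> 'b::real_normed_vector"
  assumes g: "\<And>t. (g has_vector_derivative g' t) (at t)"
    and p: "\<And>t. (p has_real_derivative p' t) (at t)"
    and le: "\<And>t. 0 < t \<Longrightarrow> t < 1 \<Longrightarrow> norm (g' t) \<le> p' t"
  shows "norm (g 1 - g 0) \<le> p 1 - p 0"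
proof (rule differentiable_bound_general[of 0 1 g p g' p'])
  show "continuous_on {0..1} g"
    by (meson g has_vector_derivative_continuous continuous_at_imp_continuous_on)
  show "continuous_on {0..1} p"
    by (meson p DERIV_isCont continuous_at_imp_continuous_on)
qed (use assms in \<open>auto simp: has_real_derivative_iff_has_vector_derivative\<close>)

text \<open>The differentiability data are kept as explicit functions: \<open>G\<close> is the gradient and
  \<open>H x\<close> the Hessian at \<open>x\<close>, read as a linear map, so that no matrices occur until
  the final instantiation.\<close>
locale smooth_objective =
  fixes f :: "'a::euclidean_space \<Rightarrow> real" and G :: "'a \<Rightarrow> 'a" and H :: "'a \<Rightarrow> 'a \<Rightarrow> 'a"
    and L \<rho> :: real
  assumes f_deriv: "(f has_derivative (\<lambda>h. h \<bullet> G x)) (at x)"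
    and G_deriv: "(G has_derivative H x) (at x)"
    and L_pos: "L > 0" and rho_pos: "\<rho> > 0"
    and G_lipschitz: "norm (G x - G y) \<le> L * norm (x - y)"
    and H_lipschitz: "norm (H x h - H y h) \<le> \<rho> * norm (x - y) * norm h"
begin

lemma linear_H: "linear (H x)"
  using G_deriv has_derivative_linear by blast

lemma f_along_line:
  "((\<lambda>t. f (x + t *\<^sub>R v)) has_vector_derivative (v \<bullet> G (x + t *\<^sub>R v))) (at t)"
proof -
  have "((\<lambda>t. f (x + t *\<^sub>R v)) has_derivative (\<lambda>s. (s *\<^sub>R v) \<bullet> G (x + t *\<^sub>R v))) (at t)"
    by (rule has_derivative_compose[of "\<lambda>t. x + t *\<^sub>R v", OF _ f_deriv])
      (auto intro!: derivative_eq_intros)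
  then show ?thesis by (simp add: has_vector_derivative_def)
qed

lemma G_along_line:
  "((\<lambda>t. G (x + t *\<^sub>R v)) has_vector_derivative (H (x + t *\<^sub>R v) v)) (at t)"
proof -
  have "((\<lambda>t. G (x + t *\<^sub>R v)) has_derivative (\<lambda>s. H (x + t *\<^sub>R v) (s *\<^sub>R v))) (at t)"
    by (rule has_derivative_compose[of "\<lambda>t. x + t *\<^sub>R v", OF _ G_deriv])
      (auto intro!: derivative_eq_intros)
  then show ?thesis by (simp add: has_vector_derivative_def linear_cmul[OF linear_H])
qed

lemma f_quadratic_bound: "\<bar>f y - f x - (y - x) \<bullet> G x\<bar> \<le> L / 2 * (norm (y - x))\<^sup>2"
proof -
  define v where "v = y - x"
  have xv: "y = v + x" by (simp add: v_def)
  have "norm ((f (x + 1 *\<^sub>R v) - 1 * (v \<bullet> G x)) - (f (x + 0 *\<^sub>R v) - 0 * (v \<bullet> G x)))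
      \<le> L / 2 * (norm v)\<^sup>2 * 1\<^sup>2 - L / 2 * (norm v)\<^sup>2 * 0\<^sup>2"
  proof (rule increment_bound_on_unit_interval)
    show "((\<lambda>t. f (x + t *\<^sub>R v) - t * (v \<bullet> G x)) has_vector_derivative
        v \<bullet> G (x + t *\<^sub>R v) - 1 * (v \<bullet> G x)) (at t)" for t
      unfolding real_scaleR_def[symmetric]
      by (intro has_vector_derivative_diff f_along_line) (auto intro!: derivative_eq_intros)
    show "((\<lambda>t. L / 2 * (norm v)\<^sup>2 * t\<^sup>2) has_real_derivative L * t * (norm v)\<^sup>2) (at t)" for t
      by (auto intro!: derivative_eq_intros)
    fix t :: real assume t: "0 < t" "t < 1"
    have "norm (v \<bullet> (G (x + t *\<^sub>R v) - G x)) \<le> norm v * (L * norm (t *\<^sub>R v))"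
      using G_lipschitz[of "x + t *\<^sub>R v" x]
      by (intro order_trans[OF Cauchy_Schwarz_ineq2[of v, folded real_norm_def]] mult_left_mono) auto
    then show "norm (v \<bullet> G (x + t *\<^sub>R v) - 1 * (v \<bullet> G x)) \<le> L * t * (norm v)\<^sup>2"
      using t by (simp add: inner_diff_right power2_eq_square algebra_simps)
  qed
  then show ?thesis unfolding v_def[symmetric] by (simp add: xv algebra_simps)
qed

lemma G_linearization_error: "norm (G y - G x - H x (y - x)) \<le> \<rho> / 2 * (norm (y - x))\<^sup>2"
proof -
  define v where "v = y - x"
  have xv: "y = v + x" by (simp add: v_def)
  have "norm ((G (x + 1 *\<^sub>R v) - 1 *\<^sub>R H x v) - (G (x + 0 *\<^sub>R v) - 0 *\<^sub>R H x v))
      \<le> \<rho> / 2 * (norm v)\<^sup>2 * 1\<^sup>2 - \<rho> / 2 * (norm v)\<^sup>2 * 0\<^sup>2"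
  proof (rule increment_bound_on_unit_interval)
    show "((\<lambda>t. G (x + t *\<^sub>R v) - t *\<^sub>R H x v) has_vector_derivative
        H (x + t *\<^sub>R v) v - 1 *\<^sub>R H x v) (at t)" for t
      by (intro has_vector_derivative_diff G_along_line) (auto intro!: derivative_eq_intros)
    show "((\<lambda>t. \<rho> / 2 * (norm v)\<^sup>2 * t\<^sup>2) has_real_derivative \<rho> * t * (norm v)\<^sup>2) (at t)" for t
      by (auto intro!: derivative_eq_intros)
    fix t :: real assume t: "0 < t" "t < 1"
    show "norm (H (x + t *\<^sub>R v) v - 1 *\<^sub>R H x v) \<le> \<rho> * t * (norm v)\<^sup>2"
      using H_lipschitz[of "x + t *\<^sub>R v" v x] t by (simp add: power2_eq_square algebra_simps)
  qed
  then show ?thesis unfolding v_def[symmetric] by (simp add: xv algebra_simps)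
qed

lemma f_quadratic_model_error:
  "\<bar>f y - f x - (y - x) \<bullet> G x - (y - x) \<bullet> H x (y - x) / 2\<bar> \<le> \<rho> / 6 * (norm (y - x))^3"
proof -
  define v where "v = y - x"
  have xv: "y = v + x" by (simp add: v_def)
  let ?g = "\<lambda>t. f (x + t *\<^sub>R v) - t *\<^sub>R (v \<bullet> G x) - (t * t / 2) *\<^sub>R (v \<bullet> H x v)"
  have "norm (?g 1 - ?g 0) \<le> \<rho> / 6 * (norm v)^3 * 1^3 - \<rho> / 6 * (norm v)^3 * 0^3"
  proof (rule increment_bound_on_unit_interval)
    show "(?g has_vector_derivative
        v \<bullet> G (x + t *\<^sub>R v) - 1 *\<^sub>R (v \<bullet> G x) - t *\<^sub>R (v \<bullet> H x v)) (at t)" for t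
      by (intro has_vector_derivative_diff f_along_line) (auto intro!: derivative_eq_intros)
    show "((\<lambda>t. \<rho> / 6 * (norm v)^3 * t^3) has_real_derivative \<rho> / 2 * t\<^sup>2 * (norm v)^3) (at t)" for t
      by (auto intro!: derivative_eq_intros)
    fix t :: real assume t: "0 < t" "t < 1"
    have "v \<bullet> G (x + t *\<^sub>R v) - 1 *\<^sub>R (v \<bullet> G x) - t *\<^sub>R (v \<bullet> H x v)
        = v \<bullet> (G (x + t *\<^sub>R v) - G x - H x (t *\<^sub>R v))"
      by (simp add: inner_diff_right linear_cmul[OF linear_H])
    also have "norm \<dots> \<le> norm v * (\<rho> / 2 * (norm (t *\<^sub>R v))\<^sup>2)"
      using G_linearization_error[of "x + t *\<^sub>R v" x]
      by (intro order_trans[OF Cauchy_Schwarz_ineq2[of v, folded real_norm_def]] mult_left_mono) auto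
    also have "\<dots> = \<rho> / 2 * t\<^sup>2 * (norm v)^3"
      using t by (simp add: power2_eq_square power3_eq_cube)
    finally show "norm (v \<bullet> G (x + t *\<^sub>R v) - 1 *\<^sub>R (v \<bullet> G x) - t *\<^sub>R (v \<bullet> H x v)) \<le> \<rho> / 2 * t\<^sup>2 * (norm v)^3" .
  qed
  then show ?thesis unfolding v_def[symmetric] by (simp add: xv algebra_simps)
qed

text \<open>The derivative of a Lipschitz map is bounded by the Lipschitz constant; the increment
  length \<open>t\<close> is chosen so that the quadratic remainder stays below the given slack.\<close>
lemma norm_H_le: "norm (H x h) \<le> L * norm h"
proof (rule field_le_epsilon)
  fix e :: real assume "e > 0"
  \<comment> \<open>The added \<open>1\<close> keeps the denominator positive when \<open>h = 0\<close>.\<close>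
  define t where "t = e / (\<rho> / 2 * (norm h)\<^sup>2 + 1)"
  have D: "\<rho> / 2 * (norm h)\<^sup>2 + 1 > 0" using rho_pos by (simp add: add_nonneg_pos)
  have t: "t > 0" using D \<open>e > 0\<close> by (simp add: t_def)
  have "t * (\<rho> / 2 * (norm h)\<^sup>2 + 1) = e" using D by (simp add: t_def)
  then have te: "t * (\<rho> / 2 * (norm h)\<^sup>2) \<le> e" using t by (simp add: algebra_simps)
  have "H x (t *\<^sub>R h) = (G (x + t *\<^sub>R h) - G x) - (G (x + t *\<^sub>R h) - G x - H x (t *\<^sub>R h))"
    by simp
  then have "norm (H x (t *\<^sub>R h)) \<le> norm (G (x + t *\<^sub>R h) - G x) + norm (G (x + t *\<^sub>R h) - G x - H x (t *\<^sub>R h))"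
    by (metis norm_triangle_ineq4)
  also have "\<dots> \<le> L * norm (t *\<^sub>R h) + \<rho> / 2 * (norm (t *\<^sub>R h))\<^sup>2"
    using G_lipschitz[of "x + t *\<^sub>R h" x] G_linearization_error[of "x + t *\<^sub>R h" x] by simp
  finally have "t * norm (H x h) \<le> t * (L * norm h + t * (\<rho> / 2 * (norm h)\<^sup>2))"
    using t by (simp add: linear_cmul[OF linear_H] algebra_simps power2_eq_square)
  then have "norm (H x h) \<le> L * norm h + t * (\<rho> / 2 * (norm h)\<^sup>2)"
    using t by (simp add: mult_le_cancel_left)
  then show "norm (H x h) \<le> L * norm h + e" using te by linarith
qed

text \<open>The mixed second difference is symmetric in \<open>h\<close> and \<open>k\<close>, and it is
  \<open>t\<^sup>2\<close> times the Hessian form up to a term of order \<open>t^3\<close>. This forces the Hessian to be symmetric.\<close>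
lemma second_difference_error:
  fixes t :: real
  assumes "t > 0"
  shows "\<bar>(f (x + t *\<^sub>R k + t *\<^sub>R h) - f (x + t *\<^sub>R h) - f (x + t *\<^sub>R k) + f x) - t\<^sup>2 * (h \<bullet> H x k)\<bar>
    \<le> t^3 * (\<rho> * (norm h + norm k)^3)"
proof -
  let ?r = "\<lambda>p. G (x + p) - G x - H x p"
  let ?g = "\<lambda>s. f ((x + t *\<^sub>R k) + s *\<^sub>R (t *\<^sub>R h)) - f (x + s *\<^sub>R (t *\<^sub>R h)) - s *\<^sub>R (t\<^sup>2 * (h \<bullet> H x k))"
  let ?g' = "\<lambda>s. (t *\<^sub>R h) \<bullet> G ((x + t *\<^sub>R k) + s *\<^sub>R (t *\<^sub>R h)) - (t *\<^sub>R h) \<bullet> G (x + s *\<^sub>R (t *\<^sub>R h))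
      - 1 *\<^sub>R (t\<^sup>2 * (h \<bullet> H x k))"
  let ?C = "t^3 * (\<rho> * (norm h + norm k)^3)"
  have "norm (?g 1 - ?g 0) \<le> ?C * 1 - ?C * 0"
  proof (rule increment_bound_on_unit_interval)
    show "(?g has_vector_derivative ?g' s) (at s)" for s
      by (intro has_vector_derivative_diff f_along_line) (auto intro!: derivative_eq_intros)
    show "((\<lambda>s. ?C * s) has_real_derivative ?C) (at s)" for s
      by (auto intro!: derivative_eq_intros)
    fix s :: real assume s: "0 < s" "s < 1"
    let ?p = "s *\<^sub>R (t *\<^sub>R h)"
    let ?n = "t * (norm h + norm k)"
    have rem: "norm (?r p) \<le> \<rho> / 2 * ?n\<^sup>2" if "norm p \<le> ?n" for p
      using G_linearization_error[of "x + p" x] rho_pos that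
      by (auto elim!: order_trans intro!: mult_left_mono power_mono)
    have p: "norm ?p \<le> t * norm h"
      using s assms by (simp add: mult_left_le_one_le)
    then have "norm (t *\<^sub>R k + ?p) \<le> ?n"
      using norm_triangle_ineq[of "t *\<^sub>R k" ?p] assms by (simp add: algebra_simps)
    moreover have "norm ?p \<le> ?n" using p assms by (simp add: algebra_simps add_increasing2)
    ultimately have rr: "norm (?r (t *\<^sub>R k + ?p) - ?r ?p) \<le> \<rho> / 2 * ?n\<^sup>2 + \<rho> / 2 * ?n\<^sup>2"
      by (intro order_trans[OF norm_triangle_ineq4] add_mono rem)
    have "?g' s = (t *\<^sub>R h) \<bullet> (?r (t *\<^sub>R k + ?p) - ?r ?p)"
      by (simp add: inner_diff_right linear_add[OF linear_H] linear_cmul[OF linear_H] add.assoc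
          power2_eq_square algebra_simps)
    also have "norm \<dots> \<le> norm (t *\<^sub>R h) * (\<rho> / 2 * ?n\<^sup>2 + \<rho> / 2 * ?n\<^sup>2)"
      by (intro order_trans[OF Cauchy_Schwarz_ineq2[of "t *\<^sub>R h", folded real_norm_def]] mult_left_mono rr) auto
    also have "\<dots> \<le> ?n * (\<rho> / 2 * ?n\<^sup>2 + \<rho> / 2 * ?n\<^sup>2)"
      using assms rho_pos by (intro mult_right_mono) (auto simp: algebra_simps)
    also have "\<dots> = ?C" by (simp add: power2_eq_square power3_eq_cube)
    finally show "norm (?g' s) \<le> ?C" .
  qed
  then show ?thesis by (simp add: algebra_simps)
qed

lemma H_symmetric: "h \<bullet> H x k = H x h \<bullet> k"
proof -
  define C where "C = 2 * (\<rho> * (norm h + norm k)^3)"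
  have C: "C \<ge> 0" using rho_pos by (simp add: C_def)
  have "\<bar>h \<bullet> H x k - k \<bullet> H x h\<bar> \<le> 0 + e" if "e > 0" for e :: real
  proof -
    define t where "t = e / (C + 1)"
    have t: "t > 0" "t * (C + 1) = e" using C that by (auto simp: t_def)
    have "\<bar>t\<^sup>2 * (h \<bullet> H x k) - t\<^sup>2 * (k \<bullet> H x h)\<bar> \<le> t^3 * C"
      using second_difference_error[OF t(1), of x k h] second_difference_error[OF t(1), of x h k]
      unfolding C_def by (simp add: add.assoc add.commute[of "t *\<^sub>R k"] add.commute[of "norm k"])
    also have "\<bar>t\<^sup>2 * (h \<bullet> H x k) - t\<^sup>2 * (k \<bullet> H x h)\<bar> = t\<^sup>2 * \<bar>h \<bullet> H x k - k \<bullet> H x h\<bar>"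
      by (simp add: abs_mult flip: right_diff_distrib)
    also have "t^3 * C = t\<^sup>2 * (t * C)" by (simp add: power2_eq_square power3_eq_cube)
    finally have "\<bar>h \<bullet> H x k - k \<bullet> H x h\<bar> \<le> t * C"
      using t(1) by simp
    then show ?thesis using t by (simp add: algebra_simps)
  qed
  then have "\<bar>h \<bullet> H x k - k \<bullet> H x h\<bar> \<le> 0" by (rule field_le_epsilon)
  then show ?thesis by (simp add: inner_commute)
qed

end

section \<open>The accelerated method on a one-dimensional quadratic\<close>

text \<open>The method on \<open>q u = c * u + \<mu> / 2 * u\<^sup>2\<close> when the gradient at step \<open>k\<close> is known up to an
  error \<open>\<delta> k\<close>. As \<open>0 - 1 = 0\<close> on natural numbers, the initial convention that the iterate with index
  \<open>- 1\<close> equals the one with index \<open>0\<close> is built into the recursion.\<close>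
locale perturbed_quadratic_agd =
  fixes a \<delta> :: "nat \<Rightarrow> real" and c \<mu> \<eta> \<theta> :: real
  assumes eta_pos: "\<eta> > 0" and theta: "0 < \<theta>" "\<theta> \<le> 1"
    and curvature: "\<bar>\<mu>\<bar> * (4 * \<eta>) \<le> 1"
    and step: "a (Suc k) = a k + (1 - \<theta>) * (a k - a (k - 1))
       - \<eta> * (c + \<mu> * (a k + (1 - \<theta>) * (a k - a (k - 1))) + \<delta> k)"
begin

definition q :: "real \<Rightarrow> real" where "q u = c * u + \<mu> / 2 * u\<^sup>2"

text \<open>The energy \<open>q (a m) + (1 - \<theta>) / (2 * \<eta>) * (a m - a (m - 1))\<^sup>2\<close> decreases up to
  the gradient errors. A curvature
  \<open>\<mu> \<ge> - \<theta> / \<eta>\<close> inflates the squared momentum \<open>((1 - \<theta>) * e)\<^sup>2\<close> by a factor of at most \<open>1 + \<theta>\<close>,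
  and \<open>(1 + \<theta>) * (1 - \<theta>)\<^sup>2 \<le> 1 - \<theta>\<close>, so the friction still dissipates \<open>\<theta> / (2 * \<eta>)\<close> times
  the squared step. A quarter of this is spent on absorbing the gradient error by Young's inequality.\<close>
lemma decrease_of_almost_convex_coordinate:
  assumes "\<mu> \<ge> - \<theta> / \<eta>"
  shows "q (a m) - q (a 0) + (1 - \<theta>) / (2 * \<eta>) * (a m - a (m - 1))\<^sup>2
    \<le> - (3 * \<theta> / (8 * \<eta>)) * (\<Sum>k<m. (a (Suc k) - a k)\<^sup>2) + 2 * \<eta> / \<theta> * (\<Sum>k<m. (\<delta> k)\<^sup>2)"
proof (induction m)
  case (Suc m)
  define e where "e = a m - a (m - 1)"
  define d where "d = a (Suc m) - a m"
  define D where "D = \<delta> m"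
  have d: "\<eta> * (c + \<mu> * (a m + (1 - \<theta>) * e) + D) = (1 - \<theta>) * e - d"
    using step[of m] by (simp add: d_def e_def D_def)
  have inc: "q (a (Suc m)) - q (a m) = d * (c + \<mu> * a m) + \<mu> / 2 * d\<^sup>2"
  proof -
    have "a (Suc m) = a m + d" by (simp add: d_def)
    then show ?thesis by (simp add: q_def power2_eq_square field_simps)
  qed
  \<comment> \<open>The step equation, multiplied by \<open>2 * d\<close>, turns the first-order term into squares.\<close>
  let ?s = "(1 - \<theta>) * e"
  have "2 * \<eta> * (q (a (Suc m)) - q (a m)) = 2 * d * (\<eta> * (c + \<mu> * (a m + ?s) + D))
      - 2 * \<eta> * \<mu> * d * ?s - 2 * \<eta> * d * D + \<eta> * \<mu> * d\<^sup>2"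
    unfolding inc by (simp add: algebra_simps power2_eq_square)
  also have "\<dots> = 2 * d * (?s - d) - 2 * \<eta> * \<mu> * d * ?s - 2 * \<eta> * d * D + \<eta> * \<mu> * d\<^sup>2"
    unfolding d ..
  also have "\<dots> = (1 - \<eta> * \<mu>) * ?s\<^sup>2 - d\<^sup>2 - (1 - \<eta> * \<mu>) * (d - ?s)\<^sup>2 - 2 * \<eta> * d * D"
    by (simp add: algebra_simps power2_eq_square)
  finally have main: "2 * \<eta> * (q (a (Suc m)) - q (a m))
    = (1 - \<eta> * \<mu>) * ?s\<^sup>2 - d\<^sup>2 - (1 - \<eta> * \<mu>) * (d - ?s)\<^sup>2 - 2 * \<eta> * d * D" .
  have l1: "\<eta> * \<mu> \<le> 1" 
  proof -
    have "\<eta> * \<mu> \<le> \<eta> * \<bar>\<mu>\<bar>" using eta_pos by simp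
    also have "\<dots> \<le> 1" using curvature eta_pos by (simp add: algebra_simps)
    finally show ?thesis .
  qed
  have l2: "1 - \<eta> * \<mu> \<le> 1 + \<theta>"
    using assms eta_pos by (simp add: field_simps)
  have "(1 - \<eta> * \<mu>) * ?s\<^sup>2 \<le> (1 + \<theta>) * ?s\<^sup>2" using l2 by (rule mult_right_mono) simp
  also have "\<dots> = (1 - \<theta>\<^sup>2) * ((1 - \<theta>) * e\<^sup>2)" by (simp add: power2_eq_square algebra_simps)
  also have "\<dots> \<le> 1 * ((1 - \<theta>) * e\<^sup>2)" using theta by (intro mult_right_mono) auto
  finally have A: "(1 - \<eta> * \<mu>) * ?s\<^sup>2 \<le> (1 - \<theta>) * e\<^sup>2" by simp
  have B: "0 \<le> (1 - \<eta> * \<mu>) * (d - ?s)\<^sup>2" using l1 by simp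
  have "0 \<le> (\<theta> * d + 4 * \<eta> * D)\<^sup>2 / \<theta>" using theta by simp
  also have "\<dots> = \<theta> * d\<^sup>2 + 8 * \<eta> * d * D + 16 * \<eta>\<^sup>2 / \<theta> * D\<^sup>2"
    using theta by (simp add: power2_eq_square field_simps)
  finally have C: "- 2 * \<eta> * d * D \<le> \<theta> / 4 * d\<^sup>2 + 4 * \<eta>\<^sup>2 / \<theta> * D\<^sup>2" by simp
  have "2 * \<eta> * (q (a (Suc m)) - q (a m)) \<le> (1 - \<theta>) * e\<^sup>2 - d\<^sup>2 + \<theta> / 4 * d\<^sup>2 + 4 * \<eta>\<^sup>2 / \<theta> * D\<^sup>2"
    using main A B C by linarith
  then have "q (a (Suc m)) - q (a m) \<le> ((1 - \<theta>) * e\<^sup>2 - d\<^sup>2 + \<theta> / 4 * d\<^sup>2 + 4 * \<eta>\<^sup>2 / \<theta> * D\<^sup>2) / (2 * \<eta>)"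
    using eta_pos by (simp add: field_simps)
  also have "\<dots> = (1 - \<theta>) / (2 * \<eta>) * e\<^sup>2 - (1 - \<theta>) / (2 * \<eta>) * d\<^sup>2 - 3 * \<theta> / (8 * \<eta>) * d\<^sup>2 + 2 * \<eta> / \<theta> * D\<^sup>2"
    using eta_pos theta by (simp add: field_simps power2_eq_square)
  finally have "q (a (Suc m)) - q (a m) \<le> \<dots>" .
  with Suc.IH[folded e_def] show ?case
    unfolding sum.lessThan_Suc diff_Suc_1 d_def[symmetric] D_def[symmetric] distrib_left by linarith
qed simp

text \<open>The increment of \<open>q\<close> is \<open>\<mu> / 2\<close> times the squared step plus the step times the slope
  \<open>g k\<close> of \<open>q\<close> at \<open>a k\<close>. The first term is the required decrease. The second would be nonpositive for
  exact gradients, since the step then always points down the slope; with errors, its positive part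
  \<open>R k\<close> satisfies a recursion with contraction factor \<open>1 - \<theta>\<close> and source \<open>\<eta> / 2 * (\<delta> k)\<^sup>2\<close>, so that
  the sum of all \<open>R k\<close> is of order \<open>\<eta> / \<theta>\<close> times the sum of the squared errors. Taking the positive
  part matters because the recursion is only summable from above when the final term is nonnegative.\<close>
lemma decrease_of_concave_coordinate:
  assumes "\<mu> < - \<theta> / \<eta>"
  shows "q (a m) - q (a 0)
    \<le> - (\<theta> / (2 * \<eta>)) * (\<Sum>k<m. (a (Suc k) - a k)\<^sup>2) + \<eta> / (2 * \<theta>) * (\<Sum>k<m. (\<delta> k)\<^sup>2)"
proof -
  define d where "d k = a (Suc k) - a k" for k
  define g where "g k = c + \<mu> * a k" for k
  define R where "R k = max 0 (d k * g k)" for k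
  have lneg: "\<mu> < 0" using assms theta eta_pos by (simp add: field_simps) (smt (verit) mult_nonneg_nonneg)
  have g_Suc: "g (Suc k) = g k + \<mu> * d k" for k by (simp add: g_def d_def algebra_simps)
  have young: "- \<eta> * G\<^sup>2 - \<eta> * D * G \<le> \<eta> / 2 * D\<^sup>2 - \<eta> / 2 * G\<^sup>2" for G D
  proof -
    have "0 \<le> \<eta> / 2 * (G + D)\<^sup>2" using eta_pos by simp
    then show ?thesis by (simp add: power2_eq_square algebra_simps)
  qed
  have R0: "R 0 \<le> \<eta> / 2 * (\<delta> 0)\<^sup>2"
  proof -
    have "d 0 = - \<eta> * (g 0 + \<delta> 0)" using step[of 0] by (simp add: d_def g_def)
    then have "d 0 * g 0 = (- \<eta> * (g 0 + \<delta> 0)) * g 0" by simp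
    also have "\<dots> = - \<eta> * (g 0)\<^sup>2 - \<eta> * \<delta> 0 * g 0" by (simp add: power2_eq_square algebra_simps)
    also have "\<dots> \<le> \<eta> / 2 * (\<delta> 0)\<^sup>2" using young[of "g 0" "\<delta> 0"] eta_pos
      by (smt (verit) zero_le_power2 mult_nonneg_nonneg half_gt_zero)
    finally show ?thesis unfolding R_def using eta_pos by (intro max.boundedI) auto
  qed
  have R_Suc: "R (Suc k) \<le> (1 - \<theta>) * R k + \<eta> / 2 * (\<delta> (Suc k))\<^sup>2" for k
  proof -
    let ?s = "(1 - \<theta>) * d k" and ?G = "g (Suc k)" and ?D = "\<delta> (Suc k)"
    have "d (Suc k) = ?s - \<eta> * (?G + \<mu> * ?s + ?D)"
      using step[of "Suc k"] by (simp add: d_def g_def algebra_simps)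
    then have "d (Suc k) * ?G = (?s - \<eta> * (?G + \<mu> * ?s + ?D)) * ?G" by simp
    also have "\<dots> = ?s * ?G - \<eta> * \<mu> * ?s * ?G + (- \<eta> * ?G\<^sup>2 - \<eta> * ?D * ?G)"
      by (simp add: power2_eq_square algebra_simps)
    also have "?s * ?G = (1 - \<theta>) * (d k * g k) + (1 - \<theta>) * \<mu> * (d k)\<^sup>2"
      by (simp add: g_Suc power2_eq_square algebra_simps)
    also have "- \<eta> * ?G\<^sup>2 - \<eta> * ?D * ?G \<le> \<eta> / 2 * ?D\<^sup>2 - \<eta> / 2 * ?G\<^sup>2" by (rule young)
    finally have 1: "d (Suc k) * ?G \<le> (1 - \<theta>) * (d k * g k) + (1 - \<theta>) * \<mu> * (d k)\<^sup>2
       - \<eta> * \<mu> * ?s * ?G + (\<eta> / 2 * ?D\<^sup>2 - \<eta> / 2 * ?G\<^sup>2)" by simp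
    \<comment> \<open>The cross term is split between the negative \<open>G\<^sup>2\<close> left by \<open>young\<close> and the curvature gain
      \<open>(1 - \<theta>) * \<mu> * (d k)\<^sup>2\<close>; the latter suffices because \<open>- \<mu> * \<eta> \<le> 1\<close>.\<close>
    have "0 \<le> \<eta> / 2 * (?G + \<mu> * ?s)\<^sup>2" using eta_pos by simp
    then have 2: "- \<eta> * \<mu> * ?s * ?G \<le> \<eta> / 2 * ?G\<^sup>2 + \<eta> / 2 * \<mu>\<^sup>2 * ?s\<^sup>2"
      by (simp add: power2_eq_square algebra_simps)
    have "\<eta> / 2 * \<mu>\<^sup>2 * ?s\<^sup>2 = ((- \<mu> * \<eta> / 2) * (1 - \<theta>)) * ((1 - \<theta>) * (- \<mu>) * (d k)\<^sup>2)"
      by (simp add: power2_eq_square field_simps)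
    also have "\<dots> \<le> 1 * ((1 - \<theta>) * (- \<mu>) * (d k)\<^sup>2)"
    proof (rule mult_right_mono)
      have "- \<mu> * \<eta> / 2 \<le> 1" using curvature lneg by (simp add: field_simps)
      moreover have "0 \<le> - \<mu> * \<eta> / 2" using lneg eta_pos by (simp add: mult_nonpos_nonneg)
      ultimately show "(- \<mu> * \<eta> / 2) * (1 - \<theta>) \<le> 1" using theta by (intro mult_le_one) auto
      show "0 \<le> (1 - \<theta>) * (- \<mu>) * (d k)\<^sup>2"
        using theta lneg by (intro mult_nonneg_nonneg) auto
    qed
    finally have "d (Suc k) * ?G \<le> (1 - \<theta>) * (d k * g k) + \<eta> / 2 * ?D\<^sup>2"
      using 1 2 by linarith
    also have "\<dots> \<le> (1 - \<theta>) * R k + \<eta> / 2 * ?D\<^sup>2"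
      using theta by (intro add_right_mono mult_left_mono) (auto simp: R_def)
    finally have "d (Suc k) * ?G \<le> (1 - \<theta>) * R k + \<eta> / 2 * ?D\<^sup>2" .
    moreover have "0 \<le> (1 - \<theta>) * R k + \<eta> / 2 * ?D\<^sup>2"
      using theta eta_pos by (intro add_nonneg_nonneg mult_nonneg_nonneg) (auto simp: R_def)
    ultimately show ?thesis by (simp add: R_def)
  qed
  have sumR: "\<theta> * (\<Sum>k<Suc m. R k) + (1 - \<theta>) * R m \<le> \<eta> / 2 * (\<Sum>k<Suc m. (\<delta> k)\<^sup>2)" for m
  proof (induction m)
    case 0 then show ?case using R0 by (simp add: algebra_simps)
  next
    case (Suc m) then show ?case using R_Suc[of m] by (simp add: algebra_simps)
  qed
  have "\<theta> * (\<Sum>k<m. R k) \<le> \<eta> / 2 * (\<Sum>k<m. (\<delta> k)\<^sup>2)"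
  proof (cases m)
    case (Suc n)
    moreover have "0 \<le> (1 - \<theta>) * R n" using theta by (simp add: R_def)
    ultimately show ?thesis using sumR[of n] by simp
  qed simp
  then have SR: "(\<Sum>k<m. R k) \<le> \<eta> / (2 * \<theta>) * (\<Sum>k<m. (\<delta> k)\<^sup>2)"
    using theta by (simp add: field_simps)
  have inc: "q (a (Suc k)) - q (a k) \<le> - (\<theta> / (2 * \<eta>)) * (d k)\<^sup>2 + R k" for k
  proof -
    have "a (Suc k) = a k + d k" by (simp add: d_def)
    then have "q (a (Suc k)) - q (a k) = \<mu> / 2 * (d k)\<^sup>2 + d k * g k"
      by (simp add: q_def g_def power2_eq_square field_simps)
    also have "\<dots> \<le> - (\<theta> / (2 * \<eta>)) * (d k)\<^sup>2 + R k"
      using assms by (intro add_mono mult_right_mono) (auto simp: R_def)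
    finally show ?thesis .
  qed
  have "q (a m) - q (a 0) = (\<Sum>k<m. q (a (Suc k)) - q (a k))"
    using sum_lessThan_telescope[of "\<lambda>k. q (a k)" m] by simp
  also have "\<dots> \<le> (\<Sum>k<m. - (\<theta> / (2 * \<eta>)) * (d k)\<^sup>2 + R k)"
    by (intro sum_mono inc)
  also have "\<dots> = - (\<theta> / (2 * \<eta>)) * (\<Sum>k<m. (d k)\<^sup>2) + (\<Sum>k<m. R k)"
    unfolding sum.distrib sum_distrib_left ..
  finally show ?thesis using SR unfolding d_def by linarith
qed

text \<open>The weaker of the two bounds, valid for every curvature, so that it can be summed over an
  eigenbasis.\<close>
lemma coordinate_decrease:
  "q (a m) - q (a 0)
    \<le> - (3 * \<theta> / (8 * \<eta>)) * (\<Sum>k<m. (a (Suc k) - a k)\<^sup>2) + 2 * \<eta> / \<theta> * (\<Sum>k<m. (\<delta> k)\<^sup>2)"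
proof (cases "\<mu> \<ge> - \<theta> / \<eta>")
  case True
  have "0 \<le> (1 - \<theta>) / (2 * \<eta>) * (a m - a (m - 1))\<^sup>2" using theta eta_pos by simp
  then show ?thesis using decrease_of_almost_convex_coordinate[OF True, of m] by linarith
next
  case False
  have "3 * \<theta> / (8 * \<eta>) * (\<Sum>k<m. (a (Suc k) - a k)\<^sup>2) \<le> \<theta> / (2 * \<eta>) * (\<Sum>k<m. (a (Suc k) - a k)\<^sup>2)"
    using theta eta_pos by (intro mult_right_mono) (auto simp: field_simps sum_nonneg)
  moreover have "\<eta> / (2 * \<theta>) * (\<Sum>k<m. (\<delta> k)\<^sup>2) \<le> 2 * \<eta> / \<theta> * (\<Sum>k<m. (\<delta> k)\<^sup>2)"
    using theta eta_pos by (intro mult_right_mono) (auto simp: field_simps sum_nonneg)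
  ultimately show ?thesis using decrease_of_concave_coordinate[of m] False by linarith
qed

end

section \<open>One round of the accelerated method\<close>

text \<open>A round is considered without its restart test; the test enters as a hypothesis on
  \<open>path_energy\<close> at a given index. The relation for \<open>\<theta>\<^sup>2\<close> replaces the explicit parameter formulas.\<close>
locale agd_round = smooth_objective f G H L \<rho>
  for f :: "'a::euclidean_space \<Rightarrow> real" and G H L \<rho> +
  fixes x y :: "nat \<Rightarrow> 'a" and \<eta> \<theta> B K :: real
  assumes y_eq: "y k = x k + (1 - \<theta>) *\<^sub>R (x k - x (k - 1))"
    and x_Suc: "x (Suc k) = y k - \<eta> *\<^sub>R G (y k)"
    and eta_eq: "\<eta> = 1 / (4 * L)" and B_pos: "B > 0"
    and theta: "0 < \<theta>" "\<theta> \<le> 1" "\<theta>\<^sup>2 = 16 * \<eta> * \<rho> * B"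
    and K_eq: "K = 1 / \<theta>"
begin

definition path_energy :: "nat \<Rightarrow> real" where
  "path_energy m = (\<Sum>k<m. (norm (x (Suc k) - x k))\<^sup>2)"

definition model_error :: "'a \<Rightarrow> 'a" where
  "model_error p = G p - G (x 0) - H (x 0) (p - x 0)"

lemma eta_pos: "\<eta> > 0" using L_pos by (simp add: eta_eq)

lemma K_ge_1: "K \<ge> 1" using theta by (simp add: K_eq)

lemma theta_K: "\<theta> * K = 1" using theta by (simp add: K_eq)

lemma inverse_eta: "1 / \<eta> = 16 * \<rho> * B * K\<^sup>2"
proof -
  have "16 * \<rho> * B * K\<^sup>2 * \<eta> = (\<theta> * K)\<^sup>2" by (simp add: theta(3) power_mult_distrib)
  then have "16 * \<rho> * B * K\<^sup>2 * \<eta> = 1" by (simp add: theta_K)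
  then show ?thesis using eta_pos by (simp only: divide_eq_eq) simp
qed

lemma y_0: "y 0 = x 0" by (simp add: y_eq)

lemma path_energy_mono: "m \<le> n \<Longrightarrow> path_energy m \<le> path_energy n"
  unfolding path_energy_def by (intro sum_mono2) auto

lemma path_energy_nonneg: "path_energy m \<ge> 0"
  unfolding path_energy_def by (intro sum_nonneg) auto

lemma displacement_le_path_energy: "(norm (x m - x 0))\<^sup>2 \<le> real m * path_energy m"
proof -
  have "x m - x 0 = (\<Sum>k<m. x (Suc k) - x k)"
    using sum_lessThan_telescope[of x m] by simp
  then have "norm (x m - x 0) \<le> (\<Sum>k<m. norm (x (Suc k) - x k))"
    by (simp add: norm_sum)
  then have "(norm (x m - x 0))\<^sup>2 \<le> (\<Sum>k<m. norm (x (Suc k) - x k))\<^sup>2"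
    by (intro power_mono) auto
  also have "\<dots> \<le> real m * path_energy m"
    using sum_squared_le_sum_of_squares[of "\<lambda>k. norm (x (Suc k) - x k)" "{..<m}"]
    by (simp add: path_energy_def mult.commute)
  finally show ?thesis .
qed

lemma restart_test_mono:
  assumes "real n * path_energy n \<le> B\<^sup>2" "m \<le> n"
  shows "real m * path_energy m \<le> B\<^sup>2"
proof -
  have "real m * path_energy m \<le> real n * path_energy n"
    using assms(2) by (intro mult_mono path_energy_mono path_energy_nonneg) auto
  then show ?thesis using assms(1) by linarith
qed

lemma path_energy_le:
  assumes "real m * path_energy m \<le> B\<^sup>2"
  shows "path_energy m \<le> B\<^sup>2"
proof (cases m)
  case 0 then show ?thesis by (simp add: path_energy_def)
next
  case (Suc n)
  then have "1 * path_energy m \<le> real m * path_energy m"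
    by (intro mult_right_mono path_energy_nonneg) auto
  then show ?thesis using assms by simp
qed

lemma x_near_start:
  assumes "real m * path_energy m \<le> B\<^sup>2"
  shows "norm (x m - x 0) \<le> B"
  using displacement_le_path_energy[of m] assms B_pos by (auto intro: power2_le_imp_le[OF order_trans])

text \<open>The extrapolation adds at most the length of one earlier step, which is at most \<open>B\<close>.\<close>
lemma y_near_start:
  assumes "real m * path_energy m \<le> B\<^sup>2"
  shows "norm (y m - x 0) \<le> 2 * B"
proof -
  have "(norm (x m - x (m - 1)))\<^sup>2 \<le> path_energy m"
    unfolding path_energy_def by (cases m) (auto simp: sum_nonneg)
  then have "norm (x m - x (m - 1)) \<le> B"
    using path_energy_le[OF assms] B_pos by (auto intro: power2_le_imp_le[OF order_trans])
  then have "(1 - \<theta>) * norm (x m - x (m - 1)) \<le> 1 * B"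
    using theta by (intro mult_mono) auto
  then have "norm (x m - x 0) + norm ((1 - \<theta>) *\<^sub>R (x m - x (m - 1))) \<le> 2 * B"
    using x_near_start[OF assms] theta by simp
  moreover have "y m - x 0 = (x m - x 0) + (1 - \<theta>) *\<^sub>R (x m - x (m - 1))" by (simp add: y_eq)
  ultimately show ?thesis by (metis norm_triangle_ineq order_trans)
qed

lemma model_error_near_start:
  assumes "norm (p - x 0) \<le> 2 * B"
  shows "norm (model_error p) \<le> 2 * \<rho> * B\<^sup>2"
proof -
  have "\<rho> / 2 * (norm (p - x 0))\<^sup>2 \<le> \<rho> / 2 * (2 * B)\<^sup>2"
    using assms rho_pos by (intro mult_left_mono power_mono) auto
  then show ?thesis using G_linearization_error[of p "x 0"] unfolding model_error_def by simp
qed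

text \<open>Along each vector of an orthonormal eigenbasis of \<open>H (x 0)\<close>, the coordinate of the iterates
  relative to \<open>x 0\<close> follows the perturbed scalar method with error the coordinate of \<open>model_error\<close>.
  Summing the scalar estimates gives the decrease of the quadratic model by Parseval's identity, and
  the cubic term accounts for replacing the model by \<open>f\<close>.\<close>
lemma model_decrease:
  "f (x m) - f (x 0) \<le> - (3 * \<theta> / (8 * \<eta>)) * path_energy m
    + 2 * \<eta> / \<theta> * (\<Sum>k<m. (norm (model_error (y k)))\<^sup>2) + \<rho> / 6 * (norm (x m - x 0))^3"
proof -
  have "\<exists>E. finite E \<and> pairwise orthogonal E
      \<and> (\<forall>b\<in>E. norm b = 1 \<and> (\<exists>l. H (x 0) b = l *\<^sub>R b)) \<and> span E = UNIV"
    by (intro symmetric_map_has_orthonormal_eigenbasis linear_H) (auto simp: H_symmetric)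
  then obtain E where E: "finite E" "pairwise orthogonal E" "span E = UNIV"
    and unit: "\<And>b. b \<in> E \<Longrightarrow> norm b = 1" and ev: "\<forall>b\<in>E. \<exists>l. H (x 0) b = l *\<^sub>R b"
    by auto
  obtain l where l: "\<And>b. b \<in> E \<Longrightarrow> H (x 0) b = l b *\<^sub>R b"
    using ev by metis
  have parseval: "u \<bullet> v = (\<Sum>b\<in>E. (u \<bullet> b) * (v \<bullet> b))" for u v
    by (rule orthonormal_inner_expansion[OF E(1,2) unit E(3)])
  have sq: "(norm u)\<^sup>2 = (\<Sum>b\<in>E. (u \<bullet> b)\<^sup>2)" for u
    unfolding power2_norm_eq_inner
    by (subst parseval) (intro sum.cong refl power2_eq_square[symmetric])
  define a where "a b k = (x k - x 0) \<bullet> b" for b k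
  define Q where "Q b u = (G (x 0) \<bullet> b) * u + l b / 2 * u\<^sup>2" for b u
  have Hb: "H (x 0) v \<bullet> b = l b * (v \<bullet> b)" if "b \<in> E" for v b
    using H_symmetric[of v "x 0" b] l[OF that] by simp
  have coord: "Q b (a b m) \<le> - (3 * \<theta> / (8 * \<eta>)) * (\<Sum>k<m. ((x (Suc k) - x k) \<bullet> b)\<^sup>2)
      + 2 * \<eta> / \<theta> * (\<Sum>k<m. (model_error (y k) \<bullet> b)\<^sup>2)" if b: "b \<in> E" for b
  proof -
    have ya: "(y k - x 0) \<bullet> b = a b k + (1 - \<theta>) * (a b k - a b (k - 1))" for k
      by (simp add: a_def y_eq inner_diff_left inner_add_left algebra_simps)
    have Gb: "G (y k) \<bullet> b = G (x 0) \<bullet> b + l b * ((y k - x 0) \<bullet> b) + model_error (y k) \<bullet> b" for k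
      using Hb[OF b, of "y k - x 0"] by (simp add: model_error_def inner_diff_left)
    have "\<bar>l b\<bar> \<le> L" using norm_H_le[of "x 0" b] l[OF b] unit[OF b] by simp
    then interpret perturbed_quadratic_agd "a b" "\<lambda>k. model_error (y k) \<bullet> b" "G (x 0) \<bullet> b" "l b" \<eta> \<theta>
    proof unfold_locales
      fix k
      have "a b (Suc k) = (y k - x 0) \<bullet> b - \<eta> * (G (y k) \<bullet> b)"
        by (simp add: a_def x_Suc inner_diff_left)
      then show "a b (Suc k) = a b k + (1 - \<theta>) * (a b k - a b (k - 1))
        - \<eta> * (G (x 0) \<bullet> b + l b * (a b k + (1 - \<theta>) * (a b k - a b (k - 1))) + model_error (y k) \<bullet> b)"
        unfolding Gb ya by simp
    qed (use eta_pos theta L_pos in \<open>auto simp: eta_eq\<close>)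
    have "a b (Suc k) - a b k = (x (Suc k) - x k) \<bullet> b" for k by (simp add: a_def inner_diff_left)
    moreover have "a b 0 = 0" by (simp add: a_def)
    ultimately show ?thesis using coordinate_decrease[of m] by (simp add: Q_def q_def)
  qed
  have swap: "(\<Sum>b\<in>E. \<Sum>k<m. (u k \<bullet> b)\<^sup>2) = (\<Sum>k<m. (norm (u k))\<^sup>2)" for u
    unfolding sq by (rule sum.swap)
  let ?v = "x m - x 0"
  have "?v \<bullet> G (x 0) + ?v \<bullet> H (x 0) ?v / 2 = (\<Sum>b\<in>E. Q b (a b m))"
    unfolding parseval[of ?v "G (x 0)"] parseval[of ?v "H (x 0) ?v"] sum_divide_distrib
      sum.distrib[symmetric]
    by (intro sum.cong) (auto simp: Q_def a_def Hb power2_eq_square)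
  also have "\<dots> \<le> (\<Sum>b\<in>E. - (3 * \<theta> / (8 * \<eta>)) * (\<Sum>k<m. ((x (Suc k) - x k) \<bullet> b)\<^sup>2)
      + 2 * \<eta> / \<theta> * (\<Sum>k<m. (model_error (y k) \<bullet> b)\<^sup>2))"
    by (intro sum_mono coord)
  also have "\<dots> = - (3 * \<theta> / (8 * \<eta>)) * path_energy m
      + 2 * \<eta> / \<theta> * (\<Sum>k<m. (norm (model_error (y k)))\<^sup>2)"
    unfolding sum.distrib sum_distrib_left[symmetric] swap path_energy_def ..
  finally show ?thesis using f_quadratic_model_error[of "x m" "x 0"] by linarith
qed

text \<open>An estimate that uses only the Lipschitz gradient: \<open>f\<close> is compared with its linearization at
  \<open>y k\<close>, at a cost of \<open>L / 2 = 1 / (8 * \<eta>)\<close> times squared distances. The energy may grow, but only by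
  \<open>1 / (8 * \<eta>)\<close> times the previous squared step.\<close>
lemma momentum_step_decrease:
  "f (x (Suc k)) + 1 / (2 * \<eta>) * (norm (x (Suc k) - x k))\<^sup>2
    \<le> f (x k) + 1 / (2 * \<eta>) * (norm (x k - x (k - 1)))\<^sup>2
      + 1 / (8 * \<eta>) * (norm (x k - x (k - 1)))\<^sup>2 - 3 / (8 * \<eta>) * (norm (x (Suc k) - y k))\<^sup>2"
proof -
  let ?u = "x (Suc k) - y k" and ?w = "x k - y k"
  have L: "L / 2 = 1 / (8 * \<eta>)" using L_pos by (simp add: eta_eq)
  have g: "G (y k) = - (1 / \<eta>) *\<^sub>R ?u" using eta_pos by (simp add: x_Suc)
  have "f (x (Suc k)) - f (x k) \<le> (?u - ?w) \<bullet> G (y k) + L / 2 * (norm ?u)\<^sup>2 + L / 2 * (norm ?w)\<^sup>2"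
    using f_quadratic_bound[of "x (Suc k)" "y k"] f_quadratic_bound[of "x k" "y k"]
    by (simp only: inner_diff_left abs_le_iff) linarith
  also have "(?u - ?w) \<bullet> G (y k) = 1 / (2 * \<eta>) * ((norm ?w)\<^sup>2 - (norm ?u)\<^sup>2 - (norm (?u - ?w))\<^sup>2)"
    unfolding g power2_norm_eq_inner using eta_pos
    by (simp only: inner_diff_left inner_diff_right inner_scaleR_right) (simp add: inner_commute field_simps)
  finally have 1: "f (x (Suc k)) - f (x k) \<le> 1 / (2 * \<eta>) * ((norm ?w)\<^sup>2 - (norm ?u)\<^sup>2 - (norm (x (Suc k) - x k))\<^sup>2)
      + 1 / (8 * \<eta>) * (norm ?u)\<^sup>2 + 1 / (8 * \<eta>) * (norm ?w)\<^sup>2" unfolding L by simp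
  have "norm ?w = (1 - \<theta>) * norm (x k - x (k - 1))" using theta by (simp add: y_eq)
  also have "\<dots> \<le> 1 * norm (x k - x (k - 1))" using theta by (intro mult_right_mono) auto
  finally have "(norm ?w)\<^sup>2 \<le> (norm (x k - x (k - 1)))\<^sup>2" by (intro power_mono) auto
  then have 2: "5 / (8 * \<eta>) * (norm ?w)\<^sup>2 \<le> 5 / (8 * \<eta>) * (norm (x k - x (k - 1)))\<^sup>2"
    using eta_pos by (intro mult_left_mono) auto
  have h: "1 / (2 * \<eta>) = 4 * (1 / (8 * \<eta>))" "3 / (8 * \<eta>) = 3 * (1 / (8 * \<eta>))"
    "5 / (8 * \<eta>) = 5 * (1 / (8 * \<eta>))" by auto
  show ?thesis using 1 2 unfolding h by (simp only: right_diff_distrib)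
qed

text \<open>If the restart is triggered by a long gradient step, the new point may be too far away for
  the quadratic model to be of use, but the gain \<open>3 / (8 * \<eta>) * B\<^sup>2\<close> of that step outweighs the growth of the energy accumulated
  over the whole round, at most \<open>1 / (8 * \<eta>) * B\<^sup>2\<close>.\<close>
lemma decrease_after_long_gradient_step:
  assumes "real m * path_energy m \<le> B\<^sup>2" "norm (x (Suc m) - y m) > B"
  shows "f (x (Suc m)) \<le> f (x 0) - B\<^sup>2 / (4 * \<eta>)"
proof -
  define P where "P k = (norm (x k - x (k - 1)))\<^sup>2" for k
  have ind: "f (x m) + 1 / (2 * \<eta>) * P m \<le> f (x 0) + 1 / (8 * \<eta>) * (\<Sum>k<m. P k)" for m
  proof (induction m)
    case 0 show ?case by (simp add: P_def)
  next
    case (Suc m)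
    have "0 \<le> 3 / (8 * \<eta>) * (norm (x (Suc m) - y m))\<^sup>2" using eta_pos by simp
    moreover have "P (Suc m) = (norm (x (Suc m) - x m))\<^sup>2" by (simp add: P_def)
    ultimately show ?case using momentum_step_decrease[of m, folded P_def] Suc
      by (simp only: sum.lessThan_Suc distrib_left)
  qed
  have "(\<Sum>k<Suc m. P k) = path_energy m"
    unfolding sum.lessThan_Suc_shift by (simp add: P_def path_energy_def)
  then have "1 / (8 * \<eta>) * ((\<Sum>k<m. P k) + P m) \<le> 1 / (8 * \<eta>) * B\<^sup>2"
    using path_energy_le[OF assms(1)] eta_pos by (intro mult_left_mono) auto
  moreover have "3 / (8 * \<eta>) * B\<^sup>2 \<le> 3 / (8 * \<eta>) * (norm (x (Suc m) - y m))\<^sup>2"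
    using assms(2) B_pos eta_pos by (intro mult_left_mono power_mono) auto
  moreover have "0 \<le> 1 / (2 * \<eta>) * (norm (x (Suc m) - x m))\<^sup>2" using eta_pos by simp
  moreover have "1 / (8 * \<eta>) * B\<^sup>2 - 3 / (8 * \<eta>) * B\<^sup>2 = - (B\<^sup>2 / (4 * \<eta>))"
    using eta_pos by (simp add: field_simps)
  ultimately show ?thesis using ind[of m] momentum_step_decrease[of m]
    unfolding P_def[symmetric] distrib_left by linarith
qed

lemma ceiling_K_le: "real_of_int \<lceil>K\<rceil> \<le> 2 * K"
  using K_ge_1 by linarith

text \<open>With \<open>w\<close> the value of the restart test, \<open>w > B\<^sup>2\<close>, the gain in the model is at least
  \<open>6 * K / \<lceil>K\<rceil> * (w / B\<^sup>2)\<close> units \<open>\<rho> * B^3\<close>. The cubic Taylor error is linear in \<open>w\<close> as well, because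
  the squared displacement is at most \<open>w\<close> and the displacement at most \<open>3 * B\<close>; hence it costs at most
  \<open>w / (2 * B\<^sup>2)\<close> units. The gradient errors cost at most half a unit in total. With
  \<open>r = \<lceil>K\<rceil> / K\<close> at most \<open>2\<close>, what remains is \<open>6 / r - 1 \<ge> r\<close> units, with equality at \<open>r = 2\<close>. A
  displacement beyond \<open>3 * B\<close> can only come from a last gradient step longer than \<open>B\<close>.\<close>
lemma restart_decrease:
  assumes run: "real m * path_energy m \<le> B\<^sup>2" and restart: "real (Suc m) * path_energy (Suc m) > B\<^sup>2"
    and m: "real m < K"
  shows "f (x (Suc m)) \<le> f (x 0) - real_of_int \<lceil>K\<rceil> / K * (\<rho> * B^3)"
proof (cases "norm (x (Suc m) - x 0) \<le> 3 * B")
  case False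
  have unit_pos: "\<rho> * B^3 > 0" using rho_pos B_pos by simp
  have "x (Suc m) - x 0 = (x (Suc m) - y m) + (y m - x 0)" by simp
  then have "norm (x (Suc m) - x 0) \<le> norm (x (Suc m) - y m) + norm (y m - x 0)"
    by (metis norm_triangle_ineq)
  then have "norm (x (Suc m) - y m) > B" using False y_near_start[OF run] by linarith
  then have "f (x (Suc m)) \<le> f (x 0) - B\<^sup>2 / (4 * \<eta>)" by (rule decrease_after_long_gradient_step[OF run])
  moreover have "real_of_int \<lceil>K\<rceil> / K * (\<rho> * B^3) \<le> B\<^sup>2 / (4 * \<eta>)"
  proof -
    have "real_of_int \<lceil>K\<rceil> / K \<le> 2" using ceiling_K_le K_ge_1 by (simp add: field_simps)
    also have "2 \<le> 4 * K\<^sup>2" using power_mono[OF K_ge_1, of 2] by simp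
    finally have "real_of_int \<lceil>K\<rceil> / K * (\<rho> * B^3) \<le> 4 * K\<^sup>2 * (\<rho> * B^3)"
      using unit_pos by (intro mult_right_mono) auto
    also have "\<dots> = B\<^sup>2 / 4 * (16 * \<rho> * B * K\<^sup>2)" by (simp add: power2_eq_square power3_eq_cube)
    also have "\<dots> = B\<^sup>2 / (4 * \<eta>)" unfolding inverse_eta[symmetric] by simp
    finally show ?thesis .
  qed
  ultimately show ?thesis by linarith
next
  case True
  define M where "M = real_of_int \<lceil>K\<rceil>"
  define w where "w = real (Suc m) * path_energy (Suc m)"
  have w: "w > B\<^sup>2" using restart by (simp add: w_def)
  have M: "real (Suc m) \<le> M" "M \<le> 2 * K" "M \<ge> 1"
  proof -
    have "int m < \<lceil>K\<rceil>" using m by (simp add: less_ceiling_iff)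
    then show "real (Suc m) \<le> M" unfolding M_def by linarith
  qed (use ceiling_K_le K_ge_1 le_of_int_ceiling[of K] in \<open>auto simp: M_def\<close>)
  have K: "K > 0" using K_ge_1 by simp
  have err: "2 * \<eta> / \<theta> * (\<Sum>k<Suc m. (norm (model_error (y k)))\<^sup>2) \<le> \<rho> * B^3 / 2"
  proof -
    \<comment> \<open>There is no error at the first step, as \<open>y 0 = x 0\<close>; this leaves \<open>m < K\<close> error terms.\<close>
    have "(\<Sum>k<Suc m. (norm (model_error (y k)))\<^sup>2) = (\<Sum>k<m. (norm (model_error (y (Suc k))))\<^sup>2)"
      unfolding sum.lessThan_Suc_shift by (simp add: y_0 model_error_def linear_0[OF linear_H])
    also have "\<dots> \<le> (\<Sum>k<m. (2 * \<rho> * B\<^sup>2)\<^sup>2)"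
      by (intro sum_mono power_mono model_error_near_start y_near_start restart_test_mono[OF run]) auto
    also have "\<dots> = real m * (2 * \<rho> * B\<^sup>2)\<^sup>2" by simp
    also have "\<dots> \<le> K * (2 * \<rho> * B\<^sup>2)\<^sup>2" using m by (intro mult_right_mono) auto
    finally have "2 * \<eta> / \<theta> * (\<Sum>k<Suc m. (norm (model_error (y k)))\<^sup>2) \<le> 2 * \<eta> / \<theta> * (K * (2 * \<rho> * B\<^sup>2)\<^sup>2)"
      using eta_pos theta by (intro mult_left_mono) auto
    also have "\<dots> = (16 * \<eta> * \<rho> * B) / \<theta>\<^sup>2 * (\<rho> * B^3 / 2)"
      by (simp add: K_eq power2_eq_square power3_eq_cube)
    also have "\<dots> = \<rho> * B^3 / 2" unfolding theta(3)[symmetric] using theta(1) by simp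
    finally show ?thesis .
  qed
  have cubic: "\<rho> / 6 * (norm (x (Suc m) - x 0))^3 \<le> \<rho> * B * w / 2"
  proof -
    have "(norm (x (Suc m) - x 0))^3 = norm (x (Suc m) - x 0) * (norm (x (Suc m) - x 0))\<^sup>2"
      by (simp add: power2_eq_square power3_eq_cube)
    also have "\<dots> \<le> 3 * B * w"
      using True displacement_le_path_energy[of "Suc m"] B_pos unfolding w_def by (intro mult_mono) auto
    finally have "\<rho> / 6 * (norm (x (Suc m) - x 0))^3 \<le> \<rho> / 6 * (3 * B * w)"
      using rho_pos by (intro mult_left_mono) auto
    then show ?thesis by (simp add: mult.commute mult.left_commute)
  qed
  have gain: "3 * \<theta> / (8 * \<eta>) * path_energy (Suc m) \<ge> \<rho> * B * (6 * K / M) * w"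
  proof -
    have "path_energy (Suc m) = w / real (Suc m)" by (simp add: w_def)
    also have "\<dots> \<ge> w / M"
      using M(1) order_trans[OF zero_le_power2 less_imp_le[OF w]] by (intro divide_left_mono) auto
    finally have "path_energy (Suc m) \<ge> w / M" .
    then have "3 * \<theta> / (8 * \<eta>) * path_energy (Suc m) \<ge> 3 * \<theta> / (8 * \<eta>) * (w / M)"
      using theta eta_pos by (intro mult_left_mono) auto
    moreover have "3 * \<theta> / (8 * \<eta>) * (w / M) = 3 / 8 * (1 / \<eta>) * \<theta> * (w / M)" by simp
    moreover have "\<dots> = 6 * \<rho> * B * K * (\<theta> * K) * (w / M)"
      unfolding inverse_eta by (simp add: power2_eq_square)
    moreover have "6 * \<rho> * B * K * (\<theta> * K) * (w / M) = \<rho> * B * (6 * K / M) * w"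
      unfolding theta_K by simp
    ultimately show ?thesis by linarith
  qed
  define r where "r = M / K"
  have r: "r > 0" "r \<le> 2" using M K by (auto simp: r_def field_simps)
  have rK: "6 * K / M = 6 / r" using M K by (simp add: r_def)
  have r6: "r + 1 \<le> 6 / r"
  proof -
    have "r * (r + 1) \<le> 2 * (2 + 1)" using r by (intro mult_mono) auto
    then show ?thesis using r(1) by (simp add: field_simps)
  qed
  have "(6 / r - 1 / 2) * B\<^sup>2 \<le> (6 / r - 1 / 2) * w"
    using w r6 r by (intro mult_left_mono) auto
  then have "\<rho> * B * ((6 / r - 1 / 2) * B\<^sup>2) \<le> \<rho> * B * ((6 / r - 1 / 2) * w)"
    by (rule mult_left_mono) (use rho_pos B_pos in auto)
  then have "\<rho> * B * (6 / r) * w - \<rho> * B * w / 2 \<ge> (6 / r - 1 / 2) * (\<rho> * B^3)"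
    by (simp add: algebra_simps power2_eq_square power3_eq_cube)
  moreover have "(6 / r - 1 / 2) * (\<rho> * B^3) \<ge> (r + 1 / 2) * (\<rho> * B^3)"
    using r6 rho_pos B_pos by (intro mult_right_mono) auto
  ultimately have "f (x (Suc m)) - f (x 0) \<le> - (r * (\<rho> * B^3))"
    using model_decrease[of "Suc m"] err cubic gain unfolding rK by (simp add: algebra_simps)
  then show ?thesis by (simp add: r_def M_def)
qed

end

section \<open>The output of the final round\<close>

text \<open>Here \<open>p\<close> is the floor of \<open>K\<close>; the output averages at least \<open>p div 2 + 1\<close> points, and
  \<open>p - p div 2\<close> steps compete for being the shortest. The inequality says that rounding \<open>K\<close> is harmless:
  the bound is the one obtained by replacing both numbers by \<open>K / 2\<close>.\<close>
lemma window_size_bound: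
  fixes p :: nat and K :: real
  assumes "p \<ge> 1" "0 \<le> K" "K \<le> real p + 1"
  shows "K^3 \<le> 8 * (real (p div 2 + 1))\<^sup>2 * real (p - p div 2)"
proof (cases "even p")
  case True
  then obtain q where q: "p = 2 * q" by (elim evenE)
  then have "real q \<ge> 1" using assms(1) by simp
  have "K^3 \<le> (2 * real q + 1)^3" using assms q by (intro power_mono) auto
  also have "\<dots> \<le> 8 * (real q + 1)\<^sup>2 * real q"
  proof -
    have "1 * 1 \<le> real q * real q" using \<open>real q \<ge> 1\<close> by (intro mult_mono) auto
    then show ?thesis using \<open>real q \<ge> 1\<close> by (simp add: power2_eq_square power3_eq_cube algebra_simps)
  qed
  finally show ?thesis using q by (simp add: add.commute)
next
  case False
  then obtain q where q: "p = 2 * q + 1" by (elim oddE)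
  have "K^3 \<le> (2 * (real q + 1))^3" using assms q by (intro power_mono) auto
  also have "\<dots> = 8 * (real q + 1)\<^sup>2 * (real q + 1)"
    by (simp add: power2_eq_square power3_eq_cube algebra_simps)
  finally show ?thesis using q by (simp add: add.commute)
qed

context agd_round
begin

lemma sum_gradient_displacement:
  "(\<Sum>k\<le>n. y k - x (Suc k)) = - (x (Suc n) - x n) - \<theta> *\<^sub>R (x n - x 0)"
proof (induction n)
  case 0 then show ?case by (simp add: y_0)
next
  case (Suc n) then show ?case by (simp add: y_eq[of "Suc n"] algebra_simps)
qed

text \<open>Since the model gradient is affine, the gradient at the average is the average of the gradients
  up to the model errors at the \<open>y k\<close> and at the average, each at most \<open>2 * \<rho> * B\<^sup>2\<close>.\<close>
lemma average_iterate:
  fixes n :: nat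
  defines "s \<equiv> real (Suc n)" and "yhat \<equiv> (1 / real (Suc n)) *\<^sub>R (\<Sum>k\<le>n. y k)"
  assumes run: "real n * path_energy n \<le> B\<^sup>2"
  shows "norm (G yhat) \<le> 1 / (\<eta> * s) * (norm (x (Suc n) - x n) + \<theta> * B) + 4 * \<rho> * B\<^sup>2"
proof -
  have s: "s > 0" by (simp add: s_def)
  have near: "norm (y k - x 0) \<le> 2 * B" if "k \<le> n" for k
    by (intro y_near_start restart_test_mono[OF run that])
  have avg_le: "norm ((1 / s) *\<^sub>R (\<Sum>k\<le>n. v k)) \<le> c" if "\<And>k. k \<le> n \<Longrightarrow> norm (v k) \<le> c" for v :: "nat \<Rightarrow> 'a" and c
  proof -
    have "norm (\<Sum>k\<le>n. v k) \<le> (\<Sum>k\<le>n. c)" using that by (intro sum_norm_le) auto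
    then have "norm (\<Sum>k\<le>n. v k) \<le> s * c" by (simp add: s_def)
    then show ?thesis using s by (simp add: field_simps)
  qed
  have avg_const: "(1 / s) *\<^sub>R (\<Sum>k\<le>n. c) = c" for c :: 'a by (simp add: s_def sum_constant_scaleR)
  have yh: "yhat - x 0 = (1 / s) *\<^sub>R (\<Sum>k\<le>n. y k - x 0)"
    unfolding sum_subtractf scaleR_diff_right avg_const by (simp add: yhat_def s_def)
  have e1: "norm (model_error yhat) \<le> 2 * \<rho> * B\<^sup>2"
    by (rule model_error_near_start) (unfold yh, intro avg_le near)
  have e2: "norm ((1 / s) *\<^sub>R (\<Sum>k\<le>n. model_error (y k))) \<le> 2 * \<rho> * B\<^sup>2"
    by (intro avg_le model_error_near_start near)
  have "(\<Sum>k\<le>n. G (y k)) = (1 / \<eta>) *\<^sub>R (\<Sum>k\<le>n. y k - x (Suc k))"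
    using eta_pos by (simp add: scaleR_sum_right x_Suc)
  then have grads: "(1 / s) *\<^sub>R (\<Sum>k\<le>n. G (y k)) = (1 / (\<eta> * s)) *\<^sub>R (- (x (Suc n) - x n) - \<theta> *\<^sub>R (x n - x 0))"
    unfolding sum_gradient_displacement by (simp add: mult.commute)
  have "(1 / s) *\<^sub>R (\<Sum>k\<le>n. G (y k)) = (1 / s) *\<^sub>R (\<Sum>k\<le>n. G (x 0) + H (x 0) (y k - x 0) + model_error (y k))"
    by (simp add: model_error_def)
  also have "\<dots> = G (x 0) + H (x 0) (yhat - x 0) + (1 / s) *\<^sub>R (\<Sum>k\<le>n. model_error (y k))"
    unfolding sum.distrib scaleR_add_right avg_const yh
    by (simp only: linear_cmul[OF linear_H] linear_sum[OF linear_H])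
  finally have "G yhat = (1 / (\<eta> * s)) *\<^sub>R (- (x (Suc n) - x n) - \<theta> *\<^sub>R (x n - x 0))
      - (1 / s) *\<^sub>R (\<Sum>k\<le>n. model_error (y k)) + model_error yhat"
    unfolding grads by (simp add: model_error_def)
  then have "norm (G yhat) \<le> norm ((1 / (\<eta> * s)) *\<^sub>R (- (x (Suc n) - x n) - \<theta> *\<^sub>R (x n - x 0)))
      + norm ((1 / s) *\<^sub>R (\<Sum>k\<le>n. model_error (y k))) + norm (model_error yhat)"
    by (simp only:) (rule order_trans[OF norm_triangle_ineq add_right_mono[OF norm_triangle_ineq4]])
  also have "norm ((1 / (\<eta> * s)) *\<^sub>R (- (x (Suc n) - x n) - \<theta> *\<^sub>R (x n - x 0)))
      \<le> 1 / (\<eta> * s) * (norm (x (Suc n) - x n) + \<theta> * B)"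
  proof -
    have "norm (- (x (Suc n) - x n) - \<theta> *\<^sub>R (x n - x 0)) \<le> norm (x (Suc n) - x n) + \<theta> * norm (x n - x 0)"
      using norm_triangle_ineq4[of "- (x (Suc n) - x n)" "\<theta> *\<^sub>R (x n - x 0)"] theta
      by (simp add: norm_minus_commute)
    also have "\<dots> \<le> norm (x (Suc n) - x n) + \<theta> * B"
      using x_near_start[OF run] theta by (intro add_left_mono mult_left_mono) auto
    finally show ?thesis using eta_pos s by (simp add: divide_right_mono)
  qed
  finally show ?thesis using e1 e2 by simp
qed

text \<open>In units of \<open>\<rho> * B\<^sup>2\<close>, the displacement contributes \<open>16 * K / s \<le> 32\<close>, the last step at most
  \<open>16 * sqrt 8\<close>, which is below \<open>46\<close>, and the model errors \<open>4\<close>. The last step is estimated by averaging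
  over the window: its square times \<open>K * c\<close> is bounded by the restart test after \<open>\<lceil>K\<rceil>\<close> steps.\<close>
lemma small_gradient_at_output:
  fixes n :: nat
  assumes run: "real_of_int \<lceil>K\<rceil> * path_energy (nat \<lceil>K\<rceil>) \<le> B\<^sup>2"
    and n: "is_arg_min (\<lambda>k. norm (x (Suc k) - x k)) (\<lambda>k. \<lfloor>K / 2\<rfloor> \<le> int k \<and> real k \<le> K - 1) n"
  shows "norm (G ((1 / real (Suc n)) *\<^sub>R (\<Sum>k\<le>n. y k))) \<le> 82 * (\<rho> * B\<^sup>2)"
proof -
  define p where "p = nat \<lfloor>K\<rfloor>"
  define s where "s = real (Suc n)"
  define c where "c = real (p - p div 2)"
  define e where "e = norm (x (Suc n) - x n)"
  have p: "int p = \<lfloor>K\<rfloor>" using K_ge_1 by (simp add: p_def)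
  have pK: "p \<ge> 1" "real p \<le> K" "K \<le> real p + 1"
    using K_ge_1 p by linarith+
  have half: "\<lfloor>K / 2\<rfloor> = int (p div 2)"
    using floor_divide_real_eq_div[of 2 K] p by (simp add: zdiv_int)
  have window: "\<lfloor>K / 2\<rfloor> \<le> int k \<and> real k \<le> K - 1 \<longleftrightarrow> k \<in> {p div 2..<p}" for k
    unfolding half using p pK by auto linarith+
  have nw: "n \<in> {p div 2..<p}" and min: "\<And>k. k \<in> {p div 2..<p} \<Longrightarrow> e \<le> norm (x (Suc k) - x k)"
    using n unfolding is_arg_min_def window e_def by (auto simp: not_less)
  have "p div 2 < p" using pK(1) by simp
  then have c: "c \<ge> 1" unfolding c_def by linarith
  have s: "s > 0" "real (p div 2 + 1) \<le> s" using nw by (auto simp: s_def)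
  have Ks: "K \<le> 2 * s" using pK(3) s(2) by linarith
  have K: "K > 0" using K_ge_1 by simp
  have pM: "p \<le> nat \<lceil>K\<rceil>" unfolding p_def by (intro nat_mono) linarith
  have M: "real (nat \<lceil>K\<rceil>) = real_of_int \<lceil>K\<rceil>" using K by simp
  have "c * e\<^sup>2 = (\<Sum>k\<in>{p div 2..<p}. e\<^sup>2)" by (simp add: c_def)
  also have "\<dots> \<le> (\<Sum>k\<in>{p div 2..<p}. (norm (x (Suc k) - x k))\<^sup>2)"
    by (intro sum_mono power_mono min) (auto simp: e_def)
  also have "\<dots> \<le> path_energy p" unfolding path_energy_def by (intro sum_mono2) auto
  also have "\<dots> \<le> path_energy (nat \<lceil>K\<rceil>)" by (rule path_energy_mono[OF pM])
  finally have "K * (c * e\<^sup>2) \<le> real_of_int \<lceil>K\<rceil> * path_energy (nat \<lceil>K\<rceil>)"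
    using K c by (intro mult_mono) auto
  then have step: "K * c * e\<^sup>2 \<le> B\<^sup>2" using run by simp
  have K3: "K^3 \<le> 8 * s\<^sup>2 * c"
  proof -
    have "K^3 \<le> 8 * (real (p div 2 + 1))\<^sup>2 * c"
      unfolding c_def using pK K by (intro window_size_bound) auto
    also have "\<dots> \<le> 8 * s\<^sup>2 * c"
      using s(2) c by (intro mult_right_mono mult_left_mono power_mono) auto
    finally show ?thesis .
  qed
  \<comment> \<open>The fraction \<open>23 / 8\<close> is a rational upper bound of \<open>sqrt 8\<close>; \<open>16 * 23 / 8 = 46\<close>.\<close>
  have last_step: "8 * (K\<^sup>2 * e) \<le> 23 * (s * B)"
  proof (rule power2_le_imp_le)
    have "c * (K\<^sup>2 * e)\<^sup>2 = K^3 * (K * c * e\<^sup>2)"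
      by (simp add: power2_eq_square power3_eq_cube)
    also have "\<dots> \<le> (8 * s\<^sup>2 * c) * B\<^sup>2"
      using K3 step K c by (intro mult_mono) auto
    finally have "c * (K\<^sup>2 * e)\<^sup>2 \<le> c * (8 * (s * B)\<^sup>2)" by (simp add: power_mult_distrib ac_simps)
    then have "(K\<^sup>2 * e)\<^sup>2 \<le> 8 * (s * B)\<^sup>2" using c by simp
    then have "64 * (K\<^sup>2 * e)\<^sup>2 \<le> 529 * (s * B)\<^sup>2"
      using zero_le_power2[of "s * B"] by linarith
    then show "(8 * (K\<^sup>2 * e))\<^sup>2 \<le> (23 * (s * B))\<^sup>2"
      unfolding power_mult_distrib[of 8] power_mult_distrib[of 23] by simp
    show "0 \<le> 23 * (s * B)" using s B_pos by simp
  qed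
  have "real n * path_energy n \<le> B\<^sup>2"
    using run nw pM by (auto simp: M intro: restart_test_mono[of "nat \<lceil>K\<rceil>"])
  from average_iterate[OF this]
  have "norm (G ((1 / real (Suc n)) *\<^sub>R (\<Sum>k\<le>n. y k))) \<le> 1 / (\<eta> * s) * (e + \<theta> * B) + 4 * \<rho> * B\<^sup>2"
    by (simp only: s_def e_def)
  also have "1 / (\<eta> * s) * (e + \<theta> * B) = (1 / \<eta>) * (e + \<theta> * B) / s" by simp
  also have "\<dots> = 16 * \<rho> * B * (K\<^sup>2 * e + K * B * (\<theta> * K)) / s"
    unfolding inverse_eta by (simp add: power2_eq_square algebra_simps)
  also have "\<dots> \<le> 16 * \<rho> * B * (39 / 8 * (s * B)) / s"
  proof (intro divide_right_mono mult_left_mono)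
    have "K * B \<le> 2 * s * B" using Ks B_pos by (intro mult_right_mono) auto
    then show "K\<^sup>2 * e + K * B * (\<theta> * K) \<le> 39 / 8 * (s * B)"
      using last_step unfolding theta_K by simp
  qed (use s rho_pos B_pos in auto)
  also have "\<dots> = 78 * (\<rho> * B\<^sup>2)" using s(1) by (simp add: power2_eq_square)
  finally show ?thesis by simp
qed

end

section \<open>Gradient and Hessian of a twice differentiable function\<close>

text \<open>The functional that is the derivative is represented by its adjoint applied to \<open>1\<close>, which makes
  the definite description of the gradient meaningful.\<close>
lemma has_derivative_gradient:
  fixes f :: "'a::euclidean_space \<Rightarrow> real"
  assumes "f differentiable (at x)"
  shows "(f has_derivative (\<lambda>h. h \<bullet> gradient f x)) (at x)"
proof -
  obtain D where D: "(f has_derivative D) (at x)" using assms by (auto simp: differentiable_def)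
  then have "linear D" by (rule has_derivative_linear)
  then have "D = (\<lambda>h. h \<bullet> adjoint D 1)" using adjoint_works[of D _ 1] by auto
  then have g: "GDERIV f x :> adjoint D 1" using D unfolding gderiv_def by simp
  have "GDERIV f x :> gradient f x" unfolding gradient_def
  proof (rule theI[of "\<lambda>u. GDERIV f x :> u", OF g])
    fix u assume "GDERIV f x :> u"
    then have "(\<lambda>h. h \<bullet> u) = (\<lambda>h. h \<bullet> adjoint D 1)"
      using g unfolding gderiv_def by (rule has_derivative_unique)
    then show "u = adjoint D 1" by (metis vector_eq_ldot)
  qed
  then show ?thesis unfolding gderiv_def .
qed

lemma has_derivative_hessian:
  fixes f :: "real^'d \<Rightarrow> real"
  assumes "gradient f differentiable (at x)"
  shows "(gradient f has_derivative (\<lambda>h. hessian f x *v h)) (at x)"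
  using assms has_derivative_linear[of "gradient f"] unfolding hessian_def
  by (metis frechet_derivative_works matrix_vector_mul(2))

lemma norm_mult_vec_le_spectral_norm: "norm (A *v v) \<le> spectral_norm A * norm v"
  for A :: "real^'n^'m"
  unfolding spectral_norm_def by (rule onorm) (simp add: matrix_vector_mul_bounded_linear)

lemma smooth_objectiveI:
  fixes f :: "real^'d \<Rightarrow> real"
  assumes "twice_differentiable f" "L > 0" "\<rho> > 0" "lipschitz_gradient L f" "lipschitz_hessian \<rho> f"
  shows "smooth_objective f (gradient f) (\<lambda>x h. hessian f x *v h) L \<rho>"
proof
  fix x y h :: "real^'d"
  show "(f has_derivative (\<lambda>h. h \<bullet> gradient f x)) (at x)"
    using assms(1) by (intro has_derivative_gradient) (auto simp: twice_differentiable_def)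
  show "(gradient f has_derivative (\<lambda>h. hessian f x *v h)) (at x)"
    using assms(1) by (intro has_derivative_hessian) (auto simp: twice_differentiable_def)
  show "norm (gradient f x - gradient f y) \<le> L * norm (x - y)"
    using assms(4) by (simp add: lipschitz_gradient_def)
  have "hessian f x *v h - hessian f y *v h = (hessian f x - hessian f y) *v h"
    by (simp add: matrix_vector_mult_diff_rdistrib)
  also have "norm \<dots> \<le> spectral_norm (hessian f x - hessian f y) * norm h"
    by (rule norm_mult_vec_le_spectral_norm)
  also have "\<dots> \<le> \<rho> * norm (x - y) * norm h"
    using assms(5) by (intro mult_right_mono) (auto simp: lipschitz_hessian_def)
  finally show "norm (hessian f x *v h - hessian f y *v h) \<le> \<rho> * norm (x - y) * norm h" .
qed (use assms in auto)

section \<open>Counting the gradients of the restarted method\<close>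

locale ragd_setting = smooth_objective f "gradient f" "\<lambda>x h. hessian f x *v h" L \<rho>
  for f :: "real^'d \<Rightarrow> real" and L \<rho> +
  fixes \<eta> \<theta> B K :: real
  assumes bdd: "bdd_below (range f)"
    and eta_eq: "\<eta> = 1 / (4 * L)" and B_pos: "B > 0"
    and theta: "0 < \<theta>" "\<theta> \<le> 1" "\<theta>\<^sup>2 = 16 * \<eta> * \<rho> * B"
    and K_eq: "K = 1 / \<theta>"
begin

text \<open>The first component of the state is the previous iterate, with \<open>0 - 1 = 0\<close> encoding that the
  iterate before the first one equals it.\<close>
lemma fst_agd: "fst (agd f \<eta> \<theta> z k) = agd_x f \<eta> \<theta> z (k - 1)"
  by (cases k) (auto simp: agd_x_def Let_def split: prod.split)

lemma agd_y_eq: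
  "agd_y f \<eta> \<theta> z k = agd_x f \<eta> \<theta> z k + (1 - \<theta>) *\<^sub>R (agd_x f \<eta> \<theta> z k - agd_x f \<eta> \<theta> z (k - 1))"
  unfolding agd_y_def fst_agd[symmetric] by (simp add: agd_x_def split: prod.split)

lemma agd_x_Suc: "agd_x f \<eta> \<theta> z (Suc k) = agd_y f \<eta> \<theta> z k - \<eta> *\<^sub>R gradient f (agd_y f \<eta> \<theta> z k)"
  by (simp add: agd_x_def agd_y_def Let_def split: prod.split)

sublocale round: agd_round f "gradient f" "\<lambda>x h. hessian f x *v h" L \<rho>
  "agd_x f \<eta> \<theta> z" "agd_y f \<eta> \<theta> z" \<eta> \<theta> B K for z
  by unfold_locales (rule agd_y_eq agd_x_Suc eta_eq B_pos theta K_eq)+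

lemma agd_x_0: "agd_x f \<eta> \<theta> z 0 = z" by (simp add: agd_x_def)

abbreviation M :: real where "M \<equiv> real_of_int \<lceil>K\<rceil>"

text \<open>The scale is such that a restart costs at least two full rounds, \<open>2 * M\<close>. It also turns
  the initial value into the stated complexity bound.\<close>
definition potential :: "real^'d \<Rightarrow> real" where
  "potential z = 2 * K / (\<rho> * B^3) * (f z - (INF x. f x))"

text \<open>The invariant of the loop. It is enough that the restart test fails at the current index,
  since it then fails at all earlier ones.\<close>
fun running :: "(real^'d) \<times> nat \<Rightarrow> bool" where
  "running (z, k) \<longleftrightarrow> real k * round.path_energy z k \<le> B\<^sup>2 \<and> real k \<le> M"

lemma K_pos: "K > 0" using theta by (simp add: K_eq)

lemma unit_pos: "\<rho> * B^3 > 0" using rho_pos B_pos by simp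

lemma M_ge_1: "M \<ge> 1" using K_pos by simp

lemma potential_nonneg: "potential z \<ge> 0"
proof -
  have "(INF x. f x) \<le> f z" using bdd by (intro cINF_lower) auto
  then show ?thesis unfolding potential_def using K_pos unit_pos by simp
qed

lemma ragd_step_eq:
  "ragd_step f \<eta> B \<theta> (z, k) = (if real (Suc k) * round.path_energy z (Suc k) > B\<^sup>2
     then (agd_x f \<eta> \<theta> z (Suc k), 0) else (z, Suc k))"
  by (simp add: ragd_step_def round.path_energy_def)

lemma restart_potential_decrease:
  assumes "running (z, k)" "real k < K" "real (Suc k) * round.path_energy z (Suc k) > B\<^sup>2"
  shows "potential (agd_x f \<eta> \<theta> z (Suc k)) + 2 * M \<le> potential z"
proof -
  have "f (agd_x f \<eta> \<theta> z (Suc k)) \<le> f z - M / K * (\<rho> * B^3)"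
    using round.restart_decrease[of k z] assms by (simp add: agd_x_0)
  then have "potential (agd_x f \<eta> \<theta> z (Suc k)) \<le> 2 * K / (\<rho> * B^3) * (f z - M / K * (\<rho> * B^3) - (INF x. f x))"
    unfolding potential_def using K_pos unit_pos by (intro mult_left_mono) auto
  also have "\<dots> = potential z - 2 * K / (\<rho> * B^3) * (M / K * (\<rho> * B^3))"
    by (simp add: potential_def algebra_simps diff_divide_distrib add_divide_distrib)
  also have "2 * K / (\<rho> * B^3) * (M / K * (\<rho> * B^3)) = 2 * M"
    using K_pos rho_pos B_pos by simp
  finally show ?thesis by simp
qed

lemma running_step:
  assumes "running (z, k)" "real k < K"
  shows "running (ragd_step f \<eta> B \<theta> (z, k))"
proof -
  have "int k < \<lceil>K\<rceil>" using assms(2) by (simp add: less_ceiling_iff)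
  then have "real (Suc k) \<le> M" by linarith
  then show ?thesis using M_ge_1 by (auto simp: ragd_step_eq)
qed

text \<open>The gradients still to be spent from \<open>(z, k)\<close> number at most \<open>max (potential z) M - k\<close>. At a
  restart the new bound is at most the old potential minus \<open>2 * M\<close>, or \<open>M\<close>; in both cases adding the at
  most \<open>M\<close> gradients of the abandoned round stays within the old potential, which was at least
  \<open>2 * M\<close>.\<close>
lemma loop_length:
  assumes "ragd_loop f \<eta> B \<theta> K s n s'" "running s"
  shows "running s' \<and> K \<le> real (snd s') \<and> real n + real (snd s) \<le> max (potential (fst s)) M"
  using assms
proof (induction rule: ragd_loop.induct)
  case (exit s)
  then show ?case by (cases s) auto
next
  case (iterate s n s')
  obtain z k where s: "s = (z, k)" by (cases s)
  have k: "real k < K" "real k \<le> M" "running (z, k)" using iterate s by auto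
  have IH: "running s'" "K \<le> real (snd s')"
    "real n + real (snd (ragd_step f \<eta> B \<theta> (z, k))) \<le> max (potential (fst (ragd_step f \<eta> B \<theta> (z, k)))) M"
    using iterate.IH running_step[OF k(3,1)] by (auto simp: s)
  have "real (Suc k) \<le> M"
  proof -
    have "int k < \<lceil>K\<rceil>" using k(1) by (simp add: less_ceiling_iff)
    then show ?thesis by linarith
  qed
  then have "real (Suc n) + real k \<le> max (potential z) M"
  proof (cases "real (Suc k) * round.path_energy z (Suc k) > B\<^sup>2")
    case True
    then show ?thesis
      using IH(3) restart_potential_decrease[OF k(3,1) True] \<open>real (Suc k) \<le> M\<close>
        potential_nonneg[of "agd_x f \<eta> \<theta> z (Suc k)"]
      by (simp add: ragd_step_eq max_def split: if_splits)
  next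
    case False
    then show ?thesis using IH(3) by (simp add: ragd_step_eq)
  qed
  then show ?case using IH s by simp
qed

text \<open>The potential plus the number of steps left in the round drops by at least one in every pass:
  a restart returns at most \<open>M\<close> steps but takes \<open>2 * M\<close> from the potential.\<close>
lemma loop_terminates:
  assumes "running (z, k)" "potential z + (M - real k) \<le> real N"
  shows "\<exists>n s'. ragd_loop f \<eta> B \<theta> K (z, k) n s'"
  using assms
proof (induction N arbitrary: z k)
  case 0
  then have "\<not> real k < K" using potential_nonneg[of z] le_of_int_ceiling[of K] by simp linarith
  then show ?case by (metis ragd_loop.exit snd_conv)
next
  case (Suc N)
  show ?case
  proof (cases "real k < K")
    case False
    then show ?thesis by (metis ragd_loop.exit snd_conv)
  next
    case True
    obtain z' k' where s: "ragd_step f \<eta> B \<theta> (z, k) = (z', k')" by fastforce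
    have "potential z' + (M - real k') \<le> real N"
    proof (cases "real (Suc k) * round.path_energy z (Suc k) > B\<^sup>2")
      case restart: True
      then have "z' = agd_x f \<eta> \<theta> z (Suc k)" "k' = 0" using s by (auto simp: ragd_step_eq)
      moreover have "real k \<le> M" using Suc.prems(1) by simp
      ultimately show ?thesis
        using restart_potential_decrease[OF Suc.prems(1) True restart] Suc.prems(2) M_ge_1
        unfolding of_nat_Suc by (simp only: of_nat_0)
    next
      case False
      then show ?thesis using Suc.prems s by (auto simp: ragd_step_eq)
    qed
    then obtain n s' where "ragd_loop f \<eta> B \<theta> K (z', k') n s'"
      using Suc.IH running_step[OF Suc.prems(1) True] s by metis
    then have "ragd_loop f \<eta> B \<theta> K (z, k) (Suc n) s'"
      using True s by (intro ragd_loop.iterate) simp_all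
    then show ?thesis by blast
  qed
qed

lemma output_exists: "\<exists>yhat. ragd_output f \<eta> \<theta> K z yhat"
proof -
  define S where "S = {k. \<lfloor>K / 2\<rfloor> \<le> int k \<and> real k \<le> K - 1}"
  have K1: "K \<ge> 1" by (rule round.K_ge_1)
  have "S \<subseteq> {..nat \<lfloor>K\<rfloor>}" unfolding S_def by (auto simp: le_nat_iff le_floor_iff)
  then have "finite S" by (rule finite_subset) simp
  moreover have "nat \<lfloor>K\<rfloor> - 1 \<in> S"
  proof -
    have "\<lfloor>K\<rfloor> \<ge> 1" using K1 by simp
    then have "K / 2 < real_of_int \<lfloor>K\<rfloor>" using floor_correct[of K] by (cases "K \<ge> 2") linarith+
    then have "\<lfloor>K / 2\<rfloor> < \<lfloor>K\<rfloor>" by (simp add: floor_less_iff)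
    moreover have "\<lfloor>K\<rfloor> \<ge> 1" using K1 by simp
    ultimately show ?thesis unfolding S_def by (auto simp: nat_diff_distrib of_nat_diff) linarith
  qed
  then have "S \<noteq> {}" by blast
  ultimately obtain k0 where "is_arg_min (\<lambda>k. norm (agd_x f \<eta> \<theta> z (k + 1) - agd_x f \<eta> \<theta> z k)) (\<lambda>k. k \<in> S) k0"
    using ex_is_arg_min_if_finite by blast
  then show ?thesis unfolding ragd_output_def S_def mem_Collect_eq by blast
qed

lemma ragd_nc_terminates: "\<exists>n yhat. ragd_nc f \<eta> B \<theta> K z n yhat"
proof -
  have "running (z, 0)" using M_ge_1 by auto
  moreover obtain N where "potential z + (M - real 0) \<le> real N" using real_arch_simple by blast
  ultimately obtain n s' where "ragd_loop f \<eta> B \<theta> K (z, 0) n s'" using loop_terminates by blast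
  moreover obtain yhat where "ragd_output f \<eta> \<theta> K (fst s') yhat" using output_exists by blast
  ultimately show ?thesis unfolding ragd_nc_def by (metis prod.collapse)
qed

lemma ragd_nc_correct:
  assumes "ragd_nc f \<eta> B \<theta> K z n yhat"
  shows "real n \<le> max (potential z) M" and "norm (gradient f yhat) \<le> 82 * (\<rho> * B\<^sup>2)"
proof -
  obtain w k where loop: "ragd_loop f \<eta> B \<theta> K (z, 0) n (w, k)" and out: "ragd_output f \<eta> \<theta> K w yhat"
    using assms by (auto simp: ragd_nc_def)
  have start: "running (z, 0)" using M_ge_1 by auto
  note L = loop_length[OF loop start]
  then show "real n \<le> max (potential z) M" by simp
  have "\<lceil>K\<rceil> = int k" using L by (simp add: eq_iff ceiling_le_iff)
  then have run: "M * round.path_energy w (nat \<lceil>K\<rceil>) \<le> B\<^sup>2" using L by simp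
  obtain k0 where "is_arg_min (\<lambda>k. norm (agd_x f \<eta> \<theta> w (Suc k) - agd_x f \<eta> \<theta> w k))
      (\<lambda>k. \<lfloor>K / 2\<rfloor> \<le> int k \<and> real k \<le> K - 1) k0"
    and "yhat = (1 / real (Suc k0)) *\<^sub>R (\<Sum>k\<le>k0. agd_y f \<eta> \<theta> w k)"
    using out unfolding ragd_output_def by auto
  then show "norm (gradient f yhat) \<le> 82 * (\<rho> * B\<^sup>2)"
    using round.small_gradient_at_output[OF run] by simp
qed

end

text \<open>All parameters are monomials in the fourth roots of \<open>\<epsilon>\<close> and \<open>\<rho>\<close> and the square root of \<open>L\<close>:
  \<open>B = e\<^sup>2 / r\<^sup>2\<close> and \<open>\<theta> = 2 * e * r / l\<close>. In these variables the relations are rational identities.\<close>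
lemma parameters_in_root_form:
  fixes L \<rho> \<epsilon> :: real
  assumes pos: "L > 0" "\<rho> > 0" "\<epsilon> > 0" and \<eta>: "\<eta> = 1 / (4 * L)" and B: "B = sqrt (\<epsilon> / \<rho>)"
    and \<theta>: "\<theta> = 4 * (\<epsilon> * \<rho> * \<eta>\<^sup>2) powr (1 / 4)" and K: "K = 1 / \<theta>"
  shows "B > 0" "\<rho> * B\<^sup>2 = \<epsilon>" "\<theta>\<^sup>2 = 16 * \<eta> * \<rho> * B"
    "2 * K / (\<rho> * B^3) = L powr (1 / 2) * \<rho> powr (1 / 4) / \<epsilon> powr (7 / 4)"
proof -
  define e r l where "e = \<epsilon> powr (1 / 4)" and "r = \<rho> powr (1 / 4)" and "l = L powr (1 / 2)"
  have p: "e > 0" "r > 0" "l > 0" using pos by (auto simp: e_def r_def l_def)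
  have e: "\<epsilon> = e^4" and r: "\<rho> = r^4" and l: "L = l\<^sup>2"
    using pos by (auto simp: e_def r_def l_def powr_power)
  have e7: "\<epsilon> powr (7 / 4) = e^7" using pos by (simp add: e_def powr_power)
  have B': "B = e\<^sup>2 / r\<^sup>2"
  proof -
    have "\<epsilon> / \<rho> = (e\<^sup>2 / r\<^sup>2)\<^sup>2" by (simp add: e r power_divide)
    then show ?thesis unfolding B using p by simp
  qed
  have \<eta>': "\<eta> = 1 / (4 * l\<^sup>2)" by (simp add: \<eta> l)
  define t where "t = e * r / (2 * l)"
  have t: "t > 0" using p by (simp add: t_def)
  have "\<epsilon> * \<rho> * \<eta>\<^sup>2 = t^4"
    by (simp add: t_def e r \<eta>' power_divide power_mult_distrib)
  also have "\<dots> = t powr 4" using t by simp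
  finally have "(\<epsilon> * \<rho> * \<eta>\<^sup>2) powr (1 / 4) = (t powr 4) powr (1 / 4)" by (simp only:)
  also have "\<dots> = t" using t unfolding powr_powr by simp
  finally have \<theta>': "\<theta> = 2 * e * r / l" unfolding \<theta> by (simp add: t_def)
  show "B > 0" using p by (simp add: B')
  show "\<rho> * B\<^sup>2 = \<epsilon>" using p by (simp add: e r B' power_divide)
  show "\<theta>\<^sup>2 = 16 * \<eta> * \<rho> * B"
    using p by (simp add: \<theta>' \<eta>' r B' power_divide power_mult_distrib field_simps eval_nat_numeral)
  have "2 * K / (\<rho> * B^3) = l * r / e^7"
    using p by (simp add: K \<theta>' r B' power_divide field_simps eval_nat_numeral)
  then show "2 * K / (\<rho> * B^3) = L powr (1 / 2) * \<rho> powr (1 / 4) / \<epsilon> powr (7 / 4)"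
    unfolding e7 by (simp add: l_def r_def)
qed

theorem theorem1:
  fixes f :: "real^'d \<Rightarrow> real"
    and L \<rho> \<epsilon> \<eta> B \<theta> K \<Delta> :: real
    and x_int :: "real^'d"
  assumes "twice_differentiable f"
    and "bdd_below (range f)"
    and "L > 0" and "\<rho> > 0"
    and "lipschitz_gradient L f"
    and "lipschitz_hessian \<rho> f"
    and "\<epsilon> > 0"
    and "\<eta> = 1 / (4 * L)"
    and "B = sqrt (\<epsilon> / \<rho>)"
    and "\<theta> = 4 * (\<epsilon> * \<rho> * \<eta>\<^sup>2) powr (1 / 4)"
    and "\<theta> \<in> {0<..1}"
    and "K = 1 / \<theta>"
    and "\<Delta> = f x_int - (INF x. f x)"
  shows "(\<exists>n yhat. ragd_nc f \<eta> B \<theta> K x_int n yhat) \<and>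
    (\<forall>n yhat. ragd_nc f \<eta> B \<theta> K x_int n yhat \<longrightarrow>
       real n \<le> max (\<Delta> * L powr (1 / 2) * \<rho> powr (1 / 4) / \<epsilon> powr (7 / 4)) (real_of_int \<lceil>K\<rceil>) \<and>
       norm (gradient f yhat) \<le> 82 * \<epsilon>)"
proof -
  note params = parameters_in_root_form[OF assms(3,4,7-10,12)]
  interpret smooth_objective f "gradient f" "\<lambda>x h. hessian f x *v h" L \<rho>
    by (rule smooth_objectiveI[OF assms(1,3-6)])
  interpret ragd_setting f L \<rho> \<eta> \<theta> B K
    by unfold_locales (use assms params in auto)
  have pot: "potential x_int = \<Delta> * L powr (1 / 2) * \<rho> powr (1 / 4) / \<epsilon> powr (7 / 4)"
    unfolding potential_def params(4) assms(13) by simp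
  show ?thesis
  proof (intro conjI allI impI)
    show "\<exists>n yhat. ragd_nc f \<eta> B \<theta> K x_int n yhat" by (rule ragd_nc_terminates)
  next
    fix n yhat assume "ragd_nc f \<eta> B \<theta> K x_int n yhat"
    note correct = ragd_nc_correct[OF this, unfolded pot params(2)]
    show "real n \<le> max (\<Delta> * L powr (1 / 2) * \<rho> powr (1 / 4) / \<epsilon> powr (7 / 4)) (real_of_int \<lceil>K\<rceil>)"
      by (rule correct(1))
    show "norm (gradient f yhat) \<le> 82 * \<epsilon>" by (rule correct(2))
  qed
qed

end
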